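(* Let $n=1$ or $N=1$ and let $f:\mathbb{R}^{N\times n}\to\mathbb{R}$. Then $f$ is level convex if and only if it is polyquasiconvex, if and only if it is rank-one quasiconvex. Moreover: (i) if $f$ is lower semicontinuous, then $f$ is level convex if and only if it is strong Morrey quasiconvex; (ii) if $f$ is upper semicontinuous, then $f$ is level convex if and only if it is weak Morrey quasiconvex, if and only if it is periodic-weak Morrey quasiconvex. In particular, if $f$ is continuous all these notions are equivalent. If $n=1$ and $f$ is Borel measurable, then $f$ is level convex if and only if it is weak Morrey quasiconvex, if and only if it is periodic-weak Morrey quasiconvex.
   Context: $Q:=(-\tfrac12,\tfrac12)^n$. Level convex: $f(\lambda\xi+(1-\lambda)\eta)\le\max\{f(\xi),f(\eta)\}$ for all $\xi,\eta$, $\lambda\in(0,1)$; rank-one quasiconvex: same whenever $\operatorname{rank}(\xi-\eta)=1$. Polyquasiconvex: $f=g\circ T$, $g$ level convex on $\mathbb{R}^{\tau(n,N)}$, $T(\xi)$ the vector of all minors of $\xi$. For Borel $f$: weak Morrey quasiconvex if $f(\xi)\le\operatorname{ess\,sup}_{Q}f(\xi+D\varphi)$ for all $\xi$, $\varphi\in W^{1,\infty}_0(Q;\mathbb{R}^N)$; periodic-weak Morrey quasiconvex if this holds for all $Q$-periodic $\varphi\in W^{1,\infty}(\mathbb{R}^n;\mathbb{R}^N)$; strong Morrey quasiconvex if for all $\varepsilon>0,\xi,K>0$ there is $\delta>0$ with: $\varphi\in W^{1,\infty}(Q;\mathbb{R}^N)$, $\|D\varphi\|_{L^\infty}\le K$,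 $\max_{\partial Q}|\varphi|\le\delta$ imply $f(\xi)\le\operatorname{ess\,sup}_Q f(\xi+D\varphi)+\varepsilon$. *)

theory Defs
  imports "HOL-Analysis.Analysis" "HOL-Probability.Essential_Supremum"
begin

text \<open>Matrices in R^{N x n} are modelled as real^'n^'m with CARD('m) = N rows
  and CARD('n) = n columns. Maps phi : R^n -> R^N are real^'n \<Rightarrow> real^'m.\<close>

definition level_convex_on :: "'a::real_vector set \<Rightarrow> ('a \<Rightarrow> real) \<Rightarrow> bool" where
  "level_convex_on S f \<longleftrightarrow>
     (\<forall>x\<in>S. \<forall>y\<in>S. \<forall>l::real. 0 < l \<and> l < 1 \<longrightarrow>
        f (l *\<^sub>R x + (1 - l) *\<^sub>R y) \<le> max (f x) (f y))"

abbreviation level_convex :: "('a::real_vector \<Rightarrow> real) \<Rightarrow> bool" where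
  "level_convex f \<equiv> level_convex_on UNIV f"

definition rank_one_quasiconvex :: "(real^'n^'m \<Rightarrow> real) \<Rightarrow> bool" where
  "rank_one_quasiconvex f \<longleftrightarrow>
     (\<forall>\<xi> \<eta>. rank (\<xi> - \<eta>) = 1 \<longrightarrow>
        (\<forall>l::real. 0 < l \<and> l < 1 \<longrightarrow> f (l *\<^sub>R \<xi> + (1 - l) *\<^sub>R \<eta>) \<le> max (f \<xi>) (f \<eta>)))"

text \<open>Minors. Rows and columns are identified with {0..<N}, {0..<n} through a fixed
  enumeration; a minor is indexed by a pair (I,J) of row/column index sets of equal
  positive cardinality, and is the (Leibniz) determinant of the corresponding square
  submatrix with rows/columns taken in increasing order.\<close>

definition enum_idx :: "nat \<Rightarrow> 'a::finite" where
  "enum_idx = (SOME e. bij_betw e {..<CARD('a)} (UNIV::'a set))"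

definition det_nat :: "nat \<Rightarrow> (nat \<Rightarrow> nat \<Rightarrow> real) \<Rightarrow> real" where
  "det_nat s A = (\<Sum>p | p permutes {..<s}. of_int (sign p) * (\<Prod>i<s. A i (p i)))"

definition minor_idx :: "'n::finite itself \<Rightarrow> 'm::finite itself \<Rightarrow> (nat set \<times> nat set) set" where
  "minor_idx _ _ = {(I, J). I \<subseteq> {..<CARD('m)} \<and> J \<subseteq> {..<CARD('n)} \<and> card I = card J \<and> 1 \<le> card I}"

definition minor :: "real^'n^'m \<Rightarrow> nat set \<Rightarrow> nat set \<Rightarrow> real" where
  "minor \<xi> I J = det_nat (card I)
     (\<lambda>a b. \<xi> $ enum_idx (sorted_list_of_set I ! a) $ enum_idx (sorted_list_of_set J ! b))"

text \<open>T(xi): the vector of all minors, an element of the tau(n,N)-dimensional space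
  {v. v vanishes outside minor_idx}.\<close>
definition minors_vec :: "real^'n^'m \<Rightarrow> (nat set \<times> nat set \<Rightarrow> real)" where
  "minors_vec \<xi> = (\<lambda>(I, J). if (I, J) \<in> minor_idx TYPE('n) TYPE('m) then minor \<xi> I J else 0)"

definition minor_space :: "'n::finite itself \<Rightarrow> 'm::finite itself \<Rightarrow> (nat set \<times> nat set \<Rightarrow> real) set" where
  "minor_space tn tm = {v. \<forall>k. k \<notin> minor_idx tn tm \<longrightarrow> v k = 0}"

definition polyquasiconvex :: "(real^'n^'m \<Rightarrow> real) \<Rightarrow> bool" where
  "polyquasiconvex f \<longleftrightarrow>
     (\<exists>g. (\<forall>v\<in>minor_space TYPE('n) TYPE('m). \<forall>w\<in>minor_space TYPE('n) TYPE('m). \<forall>l::real.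
              0 < l \<and> l < 1 \<longrightarrow> g (\<lambda>k. l * v k + (1 - l) * w k) \<le> max (g v) (g w)) \<and> (\<forall>\<xi>. f \<xi> = g (minors_vec \<xi>)))"

definition unit_cube :: "(real^'n) set" where
  "unit_cube = box (\<chi> i. - 1/2) (\<chi> i. 1/2)"

text \<open>Pointwise (a.e.) gradient of a Lipschitz map, as an N x n matrix;
  set to 0 at the (Lebesgue null) set of non-differentiability points.\<close>
definition grad :: "(real^'n \<Rightarrow> real^'m) \<Rightarrow> real^'n \<Rightarrow> real^'n^'m" where
  "grad \<phi> x = (if \<phi> differentiable (at x) then matrix (frechet_derivative \<phi> (at x)) else 0)"

definition ess_sup_Q :: "(real^'n \<Rightarrow> real) \<Rightarrow> ereal" where
  "ess_sup_Q h = esssup (lebesgue_on unit_cube) (\<lambda>x. ereal (h x))"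

text \<open>W^{1,infinity}_0(Q;R^N): Lipschitz maps vanishing outside Q (equivalently, on the boundary).\<close>
definition W1inf0_Q :: "(real^'n \<Rightarrow> real^'m) set" where
  "W1inf0_Q = {\<phi>. (\<exists>C. C-lipschitz_on UNIV \<phi>) \<and> (\<forall>x. x \<notin> unit_cube \<longrightarrow> \<phi> x = 0)}"

definition W1inf_per :: "(real^'n \<Rightarrow> real^'m) set" where
  "W1inf_per = {\<phi>. (\<exists>C. C-lipschitz_on UNIV \<phi>) \<and> bounded (range \<phi>) \<and>
                    (\<forall>x i. \<phi> (x + axis i 1) = \<phi> x)}"

text \<open>W^{1,infinity}(Q;R^N), via the Lipschitz representative extended continuously to closure Q.\<close>
definition W1inf_Q :: "(real^'n \<Rightarrow> real^'m) set" where
  "W1inf_Q = {\<phi>. \<exists>C. C-lipschitz_on (closure unit_cube) \<phi>}"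

definition weak_morrey_qc :: "(real^'n^'m \<Rightarrow> real) \<Rightarrow> bool" where
  "weak_morrey_qc f \<longleftrightarrow>
     (\<forall>\<xi> \<phi>. \<phi> \<in> W1inf0_Q \<longrightarrow> ereal (f \<xi>) \<le> ess_sup_Q (\<lambda>x. f (\<xi> + grad \<phi> x)))"

definition periodic_weak_morrey_qc :: "(real^'n^'m \<Rightarrow> real) \<Rightarrow> bool" where
  "periodic_weak_morrey_qc f \<longleftrightarrow>
     (\<forall>\<xi> \<phi>. \<phi> \<in> W1inf_per \<longrightarrow> ereal (f \<xi>) \<le> ess_sup_Q (\<lambda>x. f (\<xi> + grad \<phi> x)))"

definition strong_morrey_qc :: "(real^'n^'m \<Rightarrow> real) \<Rightarrow> bool" where
  "strong_morrey_qc f \<longleftrightarrow>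
     (\<forall>\<epsilon>>0. \<forall>\<xi>. \<forall>K>0. \<exists>\<delta>>0. \<forall>\<phi>. \<phi> \<in> W1inf_Q \<and>
        ess_sup_Q (\<lambda>x. norm (grad \<phi> x)) \<le> ereal K \<and>
        (\<forall>x\<in>frontier unit_cube. norm (\<phi> x) \<le> \<delta>) \<longrightarrow>
        ereal (f \<xi>) \<le> ess_sup_Q (\<lambda>x. f (\<xi> + grad \<phi> x)) + ereal \<epsilon>)"

definition lsc :: "('a::topological_space \<Rightarrow> real) \<Rightarrow> bool" where
  "lsc f \<longleftrightarrow> (\<forall>x. \<forall>e>0. \<forall>\<^sub>F y in at x. f x - e < f y)"

definition usc :: "('a::topological_space \<Rightarrow> real) \<Rightarrow> bool" where
  "usc f \<longleftrightarrow> (\<forall>x. \<forall>e>0. \<forall>\<^sub>F y in at x. f y < f x + e)"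

end

theory Submission
  imports Defs "HOL-Probability.Probability_Measure"
begin

text \<open>If \<open>f\<close> is level convex, its sublevel sets are convex, so they contain the mean of any integrable map
  taking values in them; the mean of \<open>\<xi> + D\<phi>\<close> over \<open>Q\<close> is \<open>\<xi>\<close> when \<open>\<phi>\<close> is periodic or vanishes on the boundary,
  and is close to \<open>\<xi>\<close> when \<open>\<phi>\<close> is small there.

  Conversely, for \<open>n = 1\<close> or \<open>N = 1\<close> the endpoints of a segment differ by some \<open>a \<otimes> b\<close>, and one tests with \<open>\<phi> = u a\<close>,
  \<open>u\<close> scalar and piecewise affine, whose gradients reproduce the two endpoints. A fine laminate does this with small
  boundary values, which settles the strong condition; for \<open>n = 1\<close> a single tent even vanishes on the boundary. For
  \<open>n > 1\<close> the boundary condition forces a branching of the laminate towards the boundary; it perturbs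
  the gradients by an arbitrarily small amount, which upper semicontinuity absorbs.\<close>

section \<open>Means in convex sets and mean gradients\<close>

text \<open>Sublevel sets of a level convex function need not be closed, while the weak conditions
  demand an exact inequality. So the mean of the gradient has to lie in the convex set itself and
  not just in its closure. Closedness enters for the strong condition, where the mean is known only
  up to an error: there lower semicontinuity turns a gap in value into a gap in distance.

  For the converse, laminates are written as infima of countably many nonnegative piecewise affine
  functions. An infimum inherits a common Lipschitz constant, and once finitely many terms decide it
  near each point, its gradients are slopes of single terms off a null set. Such a gradient is
  locally constant on an open set of full measure in the cube, which is where the measurability of
  \<open>f (\<xi> + grad \<phi> x)\<close> comes from. This matters because \<open>esssup\<close> of
  a non-measurable function is top, which would make the Morrey inequality empty.\<close>

text \<open>If the mean were outside \<open>C\<close>, a hyperplane would separate it weakly from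
  \<open>C\<close>. The affine function defining the hyperplane is then nonnegative along
  \<open>X\<close> with mean at most 0, so it vanishes almost everywhere, and \<open>X\<close> lives
  in a slice of \<open>C\<close> of smaller dimension, to which induction applies.\<close>

lemma (in prob_space) integral_in_convex:
  fixes X :: "'a \<Rightarrow> 'b::euclidean_space"
  assumes "convex C" and X: "integrable M X" and "AE w in M. X w \<in> C"
  shows "(LINT w|M. X w) \<in> C"
  using assms(1,3)
\<comment> \<open>The \<open>+ 1\<close> is there because the empty set has affine dimension
  -1.\<close>
proof (induction "nat (aff_dim C + 1)" arbitrary: C rule: less_induct)
  case less
  let ?z = "LINT w|M. X w"
  have ne: "C \<noteq> {}"
    using less.prems(2) AE_False by auto
  show ?case
  proof (rule ccontr)
    assume z: "?z \<notin> C"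
    obtain a b where ab: "?z + a \<in> affine hull (insert ?z C)" "a \<noteq> 0" "a \<bullet> ?z \<le> b"
      "\<And>x. x \<in> C \<Longrightarrow> a \<bullet> x \<ge> b"
      using separating_hyperplane_set_point_inaff[OF less.prems(1) ne z] by metis
    have ge: "AE w in M. 0 \<le> a \<bullet> X w - b"
      using less.prems(2) by eventually_elim (use ab(4) in auto)
    have int: "integrable M (\<lambda>w. a \<bullet> X w - b)"
      using X by simp
    have eq: "(LINT w|M. a \<bullet> X w - b) = a \<bullet> ?z - b"
      using X by (simp add: prob_space)
    moreover have "0 \<le> (LINT w|M. a \<bullet> X w - b)"
      using ge by (rule integral_nonneg_AE)
    ultimately have zb: "a \<bullet> ?z = b" using ab(3) by linarith
    then have "AE w in M. a \<bullet> X w - b = 0"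
      using integral_nonneg_eq_0_iff_AE[OF int ge] eq by simp
    with less.prems(2) have in': "AE w in M. X w \<in> C \<inter> {x. a \<bullet> x = b}"
      by eventually_elim auto
    have hyp: "affine {x. a \<bullet> x = b}" by (rule affine_hyperplane)
    \<comment> \<open>The normal \<open>a\<close> is a direction of the affine hull of the mean and
      \<open>C\<close>; a hyperplane containing both would make \<open>a\<close> orthogonal to
      itself.\<close>
    have notsub: "\<not> C \<subseteq> {x. a \<bullet> x = b}"
    proof
      assume "C \<subseteq> {x. a \<bullet> x = b}"
      then have "affine hull (insert ?z C) \<subseteq> {x. a \<bullet> x = b}"
        using zb hyp by (intro hull_minimal) auto
      then have "a \<bullet> (?z + a) = b" using ab(1) by auto
      with zb ab(2) show False by (simp add: inner_add_right)
    qed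
    have "affine hull (C \<inter> {x. a \<bullet> x = b}) \<subset> affine hull C"
    proof
      show "affine hull (C \<inter> {x. a \<bullet> x = b}) \<subseteq> affine hull C" by (rule hull_mono) auto
      have "affine hull (C \<inter> {x. a \<bullet> x = b}) \<subseteq> {x. a \<bullet> x = b}"
        using hyp by (intro hull_minimal) auto
      with notsub show "affine hull (C \<inter> {x. a \<bullet> x = b}) \<noteq> affine hull C"
        using hull_subset[of C affine] by auto
    qed
    then have "aff_dim (C \<inter> {x. a \<bullet> x = b}) < aff_dim C"
      by (rule aff_dim_psubset)
    moreover have "aff_dim (C \<inter> {x. a \<bullet> x = b}) \<ge> -1" by (rule aff_dim_geq)
    ultimately have "nat (aff_dim (C \<inter> {x. a \<bullet> x = b}) + 1) < nat (aff_dim C + 1)" by linarith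
    moreover have "convex (C \<inter> {x. a \<bullet> x = b})"
      using less.prems(1) hyp affine_imp_convex convex_Int by blast
    ultimately have "?z \<in> C \<inter> {x. a \<bullet> x = b}" using less.hyps in' by blast
    with z show False by blast
  qed
qed

section \<open>The mean of a gradient over the cube\<close>

text \<open>The box \<open>?B\<close>, the cube lengthened by \<open>h\<close> along the axis, is
  cut in two ways: at 1/2 into the cube and a far slab, at -1/2 + h into a near slab and the shifted
  cube. Equating the two sums reduces a difference over the cube to a comparison of thin slabs at
  opposite faces.\<close>

lemma integral_translation_difference:
  fixes g :: "real^'n \<Rightarrow> 'b::euclidean_space" and i :: 'n
  assumes g: "continuous_on UNIV g" and h: "0 \<le> h" "h \<le> 1"
  defines "e \<equiv> axis i 1"
  defines "a \<equiv> (\<chi> j. - 1/2)" and "b \<equiv> (\<chi> j. 1/2)" and "c \<equiv> (\<chi> j. if j = i then - 1/2 + h else 1/2)"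
  shows "integral (cbox a b) (\<lambda>x. g (x + h *\<^sub>R e) - g x) = integral (cbox a c) (\<lambda>x. g (x + e) - g x)"
proof -
  have int: "g integrable_on cbox u v" "(\<lambda>x. g (x + w)) integrable_on cbox u v" for u v w
     apply (rule integrable_continuous, rule continuous_on_subset[OF g], simp)
    apply (rule integrable_continuous, rule continuous_on_compose2[OF g])
     apply (intro continuous_intros, simp)
    done
  have shift: "integral (cbox u v) (\<lambda>x. g (x + w)) = integral (cbox (u + w) (v + w)) g" for u v w
    using integral_shift_cbox_plus[of u v g w] by (simp add: o_def add.commute)
  have e: "e \<in> Basis" by (simp add: e_def)
  have inn: "x \<bullet> e = x $ i" for x by (simp add: e_def inner_axis)
  let ?B = "cbox a (b + h *\<^sub>R e)"
  have e': "e $ j = (if j = i then 1 else 0)" for j by (simp add: e_def axis_def)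
  have 1: "?B \<inter> {x. x \<bullet> e \<le> 1/2} = cbox a b"
    "?B \<inter> {x. x \<bullet> e \<ge> 1/2} = cbox (a + e) (c + e)"
    "?B \<inter> {x. x \<bullet> e \<le> -1/2 + h} = cbox a c"
    "?B \<inter> {x. x \<bullet> e \<ge> -1/2 + h} = cbox (a + h *\<^sub>R e) (b + h *\<^sub>R e)"
  proof -
    have sl: "x \<in> cbox u v \<longleftrightarrow> (u$i \<le> x$i \<and> x$i \<le> v$i) \<and> (\<forall>j. j \<noteq> i \<longrightarrow> u$j \<le> x$j \<and> x$j \<le> v$j)" for x u v :: "real^'n"
      unfolding mem_box_cart by metis
    define R where "R x \<longleftrightarrow> (\<forall>j. j \<noteq> i \<longrightarrow> -1/2 \<le> x$j \<and> x$j \<le> 1/2)" for x :: "real^'n"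
    have *: "x \<in> cbox a b \<longleftrightarrow> (-1/2 \<le> x$i \<and> x$i \<le> 1/2) \<and> R x"
      "x \<in> ?B \<longleftrightarrow> (-1/2 \<le> x$i \<and> x$i \<le> 1/2 + h) \<and> R x"
      "x \<in> cbox (a + e) (c + e) \<longleftrightarrow> (1/2 \<le> x$i \<and> x$i \<le> 1/2 + h) \<and> R x"
      "x \<in> cbox a c \<longleftrightarrow> (-1/2 \<le> x$i \<and> x$i \<le> -1/2 + h) \<and> R x"
      "x \<in> cbox (a + h *\<^sub>R e) (b + h *\<^sub>R e) \<longleftrightarrow> (-1/2 + h \<le> x$i \<and> x$i \<le> 1/2 + h) \<and> R x" for x
      unfolding sl by (simp_all add: a_def b_def c_def e' R_def cong: conj_cong)
    show "?B \<inter> {x. x \<bullet> e \<le> 1/2} = cbox a b"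
    "?B \<inter> {x. x \<bullet> e \<ge> 1/2} = cbox (a + e) (c + e)"
    "?B \<inter> {x. x \<bullet> e \<le> -1/2 + h} = cbox a c"
    "?B \<inter> {x. x \<bullet> e \<ge> -1/2 + h} = cbox (a + h *\<^sub>R e) (b + h *\<^sub>R e)"
      unfolding set_eq_iff Int_iff mem_Collect_eq * inn using h by auto
  qed
  have "integral (cbox a b) g + integral (cbox (a + e) (c + e)) g
     = integral (cbox a c) g + integral (cbox (a + h *\<^sub>R e) (b + h *\<^sub>R e)) g"
    using integral_split[OF int(1) e, of a "b + h *\<^sub>R e" "1/2"]
      integral_split[OF int(1) e, of a "b + h *\<^sub>R e" "-1/2 + h"] unfolding 1 by simp
  then show ?thesis
    unfolding integral_diff[OF int(2,1)] shift by (simp add: algebra_simps)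
qed

text \<open>This takes the place of integrating along lines: the difference quotients are bounded by
  \<open>L\<close> and converge on \<open>S\<close>, so by dominated convergence their means tend to
  that of \<open>D\<close>, and each of these means sees only the slabs at opposite faces.\<close>

lemma mean_partial_derivative_bound:
  fixes g :: "real^'n \<Rightarrow> 'b::euclidean_space"
  assumes lip: "L-lipschitz_on UNIV g"
    and S: "S \<subseteq> cbox (\<chi> j. - 1/2) (\<chi> j. 1/2)" "negligible (cbox (\<chi> j. - 1/2) (\<chi> j. 1/2) - S)"
    and D: "\<And>x. x \<in> S \<Longrightarrow> ((\<lambda>h. (g (x + h *\<^sub>R axis i 1) - g x) /\<^sub>R h) \<longlongrightarrow> D x) (at_right 0)"
    and face: "\<And>x. x \<in> cbox (\<chi> j. - 1/2) (\<chi> j. 1/2) \<Longrightarrow> x $ i = - 1/2 \<Longrightarrow> norm (g (x + axis i 1) - g x) \<le> \<delta>"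
  shows "D integrable_on S" "norm (integral S D) \<le> \<delta>" "\<And>x. x \<in> S \<Longrightarrow> norm (D x) \<le> L"
proof -
  let ?Q = "cbox (\<chi> j. - 1/2) (\<chi> j. 1/2) :: (real^'n) set"
  define e :: "real^'n" where "e = axis i 1"
  have ne: "norm e = 1" by (simp add: e_def)
  define t where "t k = inverse (real (Suc k))" for k
  have t: "0 < t k" "t k \<le> 1" for k by (auto simp: t_def field_simps)
  have t0: "t \<longlonglongrightarrow> 0" unfolding t_def by (rule LIMSEQ_inverse_real_of_nat)
  have tr: "filterlim t (at_right 0) sequentially"
    unfolding filterlim_at using t0 by (simp add: t(1) less_imp_neq[OF t(1), symmetric])
  define q where "q k x = (g (x + t k *\<^sub>R e) - g x) /\<^sub>R t k" for k x
  have conv: "(\<lambda>k. q k x) \<longlonglongrightarrow> D x" if "x \<in> S" for x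
    using filterlim_compose[OF D[OF that] tr] by (simp add: q_def e_def)
  have qb: "norm (q k x) \<le> L" for k x
    using lipschitz_on_normD[OF lip, of "x + t k *\<^sub>R e" x] t[of k]
    unfolding q_def norm_scaleR by (simp add: ne divide_simps mult.commute)
  have cg: "continuous_on UNIV g" using lip by (rule lipschitz_on_continuous_on)
  have cq: "continuous_on UNIV (q k)" for k
    unfolding q_def by (intro continuous_intros continuous_on_compose2[OF cg]) auto
  have sp: "f integrable_on S \<longleftrightarrow> f integrable_on ?Q" for f :: "real^'n \<Rightarrow> 'c::euclidean_space"
    by (rule integrable_spike_set_eq) (use S in \<open>auto simp: Diff_eq_empty_iff[THEN iffD2]\<close>)
  have qi: "q k integrable_on ?Q" for k
    by (rule integrable_continuous) (use cq continuous_on_subset in blast)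
  have qS: "q k integrable_on S" for k using qi sp by blast
  have cS: "(\<lambda>x. L) integrable_on S" unfolding sp by (rule integrable_const)
  note dc = dominated_convergence[OF qS cS qb conv]
  show "D integrable_on S" using dc by simp
  show "norm (D x) \<le> L" if "x \<in> S" for x
    by (rule Lim_bounded[OF tendsto_norm[OF conv[OF that]]]) (use qb in auto)
  \<comment> \<open>A point of the slab and its translate are each within \<open>h\<close> of their
    faces, which costs \<open>2 * L * h\<close> on top of \<open>\<delta>\<close>; the slab has
    volume \<open>h\<close>, cancelling the division in the quotient.\<close>
  have intq: "norm (integral S (q k)) \<le> \<delta> + 2 * L * t k" for k
  proof -
    define h where "h = t k"
    have h: "0 < h" "h \<le> 1" using t by (auto simp: h_def)
    define c :: "real^'n" where "c = (\<chi> j. if j = i then - 1/2 + h else 1/2)"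
    have L: "L \<ge> 0" using lip by (rule lipschitz_on_nonneg)
    have "integral S (q k) = integral ?Q (q k)"
      by (rule integral_spike_set) (use S in \<open>auto intro: negligible_subset[OF S(2)] negligible_subset[OF negligible_empty]\<close>)
    also have "\<dots> = (integral ?Q (\<lambda>x. g (x + h *\<^sub>R e) - g x)) /\<^sub>R h"
      unfolding q_def h_def by simp
    also have "\<dots> = (integral (cbox (\<chi> j. - 1/2) c) (\<lambda>x. g (x + e) - g x)) /\<^sub>R h"
      using integral_translation_difference[OF cg, of h i] h by (simp add: e_def c_def)
    finally have eq: "integral S (q k) = \<dots>" .
    have "norm (integral (cbox (\<chi> j. - 1/2) c) (\<lambda>x. g (x + e) - g x)) \<le> (\<delta> + 2 * L * h) * measure lborel (cbox (\<chi> j. - 1/2) c)"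
    proof (rule has_integral_bound[OF _ integrable_integral])
      show "0 \<le> \<delta> + 2 * L * h"
      proof -
        have "norm (g ((\<chi> j. - 1/2) + axis i 1) - g (\<chi> j. - 1/2)) \<le> \<delta>"
          by (rule face) (auto simp: mem_box_cart)
        then have "0 \<le> \<delta>" using norm_ge_zero order_trans by blast
        then show ?thesis using L h by auto
      qed
      show "(\<lambda>x. g (x + e) - g x) integrable_on cbox (\<chi> j. - 1/2) c"
        by (intro integrable_continuous continuous_intros continuous_on_compose2[OF cg]
            continuous_on_subset[OF cg]) auto
      fix x assume x: "x \<in> cbox (\<chi> j. - 1/2) c"
      define s where "s = x $ i + 1/2"
      have s: "0 \<le> s" "s \<le> h" using x unfolding mem_box_cart by (auto simp: s_def c_def dest: spec[of _ i])
      define y where "y = x - s *\<^sub>R e"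
      have yi: "y $ i = -1/2" by (simp add: y_def e_def s_def)
      have yj: "y $ j = x $ j" if "j \<noteq> i" for j using that by (simp add: y_def e_def axis_def)
      have "y \<in> ?Q" unfolding mem_box_cart
      proof (intro allI)
        fix j show "(\<chi> j. - 1/2) $ j \<le> y $ j \<and> y $ j \<le> (\<chi> j. 1/2) $ j"
          using x yi yj[of j] unfolding mem_box_cart c_def by (cases "j = i") (auto dest: spec[of _ j])
      qed
      then have 1: "norm (g (y + e) - g y) \<le> \<delta>" using face yi by (simp add: e_def)
      have 2: "norm (g (x + e) - g (y + e)) \<le> L * h" "norm (g x - g y) \<le> L * h"
        using lipschitz_on_normD[OF lip, of "x + e" "y + e"] lipschitz_on_normD[OF lip, of x y] s
          mult_left_mono[OF s(2) L]
        by (auto simp: y_def ne)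
      have eq: "g (x + e) - g x = (g (x + e) - g (y + e)) + (g (y + e) - g y) - (g x - g y)" by simp
      show "norm (g (x + e) - g x) \<le> \<delta> + 2 * L * h"
        using norm_triangle_ineq4[of "(g (x + e) - g (y + e)) + (g (y + e) - g y)" "g x - g y"]
          norm_triangle_ineq[of "g (x + e) - g (y + e)" "g (y + e) - g y"] 1 2 unfolding eq[symmetric]
        by linarith
    qed
    also have "measure lborel (cbox (\<chi> j. - 1/2) c) = h"
    proof -
      have ne: "cbox (\<chi> j. - 1/2) c \<noteq> {}"
        using h by (auto simp: interval_eq_empty_cart c_def not_less)
      have "(\<Prod>j\<in>UNIV. c $ j - (\<chi> j. - 1/2) $ j) = (\<Prod>j\<in>UNIV. if j = i then h else 1)"
        by (rule prod.cong) (auto simp: c_def)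
      then show ?thesis unfolding content_cbox_cart[OF ne] by simp
    qed
    finally show ?thesis unfolding eq using h by (simp add: field_simps h_def)
  qed
  have "(\<lambda>k. \<delta> + 2 * L * t k) \<longlonglongrightarrow> \<delta> + 2 * L * 0" by (intro tendsto_intros t0)
  then show "norm (integral S D) \<le> \<delta>"
    using LIMSEQ_le[OF tendsto_norm[OF dc(2)]] intq by auto
qed

lemma has_derivative_directional_limit:
  assumes "(g has_derivative g') (at x)"
  shows "((\<lambda>h. (g (x + h *\<^sub>R v) - g x) /\<^sub>R h) \<longlongrightarrow> g' v) (at_right 0)"
proof -
  have lin: "linear g'" using assms has_derivative_linear by blast
  have "((\<lambda>h. x + h *\<^sub>R v) has_derivative (\<lambda>h. h *\<^sub>R v)) (at 0)"
    by (auto intro!: derivative_eq_intros)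
  then have "((\<lambda>h. g (x + h *\<^sub>R v)) has_derivative (\<lambda>h. g' (h *\<^sub>R v))) (at 0)"
    using diff_chain_at[of "\<lambda>h. x + h *\<^sub>R v" "\<lambda>h. h *\<^sub>R v" 0 g g'] assms by (simp add: o_def)
  then have "((\<lambda>h. norm (g (x + h *\<^sub>R v) - g x - g' (h *\<^sub>R v)) / norm h) \<longlongrightarrow> 0) (at 0)"
    by (simp add: has_derivative_iff_norm)
  moreover have "norm (g (x + h *\<^sub>R v) - g x - g' (h *\<^sub>R v)) / norm h
      = norm ((g (x + h *\<^sub>R v) - g x) /\<^sub>R h - g' v)" if "h \<noteq> 0" for h
  proof -
    have "(g (x + h *\<^sub>R v) - g x) /\<^sub>R h - g' v = (g (x + h *\<^sub>R v) - g x - g' (h *\<^sub>R v)) /\<^sub>R h"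
      using that by (simp add: linear_cmul[OF lin] scaleR_right_diff_distrib)
    then show ?thesis by (simp add: divide_inverse mult.commute)
  qed
  ultimately have "((\<lambda>h. norm ((g (x + h *\<^sub>R v) - g x) /\<^sub>R h - g' v)) \<longlongrightarrow> 0) (at 0)"
    by (subst (asm) tendsto_cong) (auto simp: eventually_at_filter)
  then have "((\<lambda>h. (g (x + h *\<^sub>R v) - g x) /\<^sub>R h) \<longlongrightarrow> g' v) (at 0)"
    using tendsto_norm_zero_iff LIM_zero_iff by blast
  then show ?thesis by (rule tendsto_within_subset) auto
qed

lemma unit_cube_in_lebesgue [simp, measurable]: "unit_cube \<in> sets lebesgue"
  and open_unit_cube: "open unit_cube"
  unfolding unit_cube_def by (simp_all add: open_box)

lemma closure_unit_cube: "closure (unit_cube :: (real^'n) set) = cbox (\<chi> j. - 1/2) (\<chi> j. 1/2)"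
  unfolding unit_cube_def by (rule closure_box) (auto simp: interval_eq_empty_cart not_le)

lemma mem_unit_cube: "x \<in> unit_cube \<longleftrightarrow> (\<forall>i. \<bar>x $ i\<bar> < 1/2)"
proof -
  have "- 1/2 < t \<and> t < 1/2 \<longleftrightarrow> \<bar>t\<bar> < 1/2" for t :: real by arith
  then show ?thesis unfolding unit_cube_def mem_box_cart vec_lambda_beta by blast
qed

lemma prob_space_unit_cube: "prob_space (lebesgue_on (unit_cube :: (real^'n) set))"
proof
  have "emeasure (lebesgue_on (unit_cube :: (real^'n) set)) (space (lebesgue_on unit_cube)) = emeasure lborel (unit_cube :: (real^'n) set)"
    by (simp add: space_restrict_space emeasure_restrict_space emeasure_completion unit_cube_def)
  also have "\<dots> = ennreal (\<Prod>b\<in>Basis. ((\<chi> j. 1/2) - (\<chi> j. - 1/2) :: real^'n) \<bullet> b)"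
    unfolding unit_cube_def by (rule emeasure_lborel_box) (auto simp: Basis_vec_def inner_axis)
  also have "(\<Prod>b\<in>Basis. ((\<chi> j. 1/2) - (\<chi> j. - 1/2) :: real^'n) \<bullet> b) = 1"
    by (rule prod.neutral) (auto simp: Basis_vec_def inner_axis)
  finally show "emeasure (lebesgue_on (unit_cube :: (real^'n) set)) (space (lebesgue_on unit_cube)) = 1" by simp
qed

lemma grad_nth:
  "\<phi> differentiable (at x) \<Longrightarrow> grad \<phi> x $ k $ i = frechet_derivative \<phi> (at x) (axis i 1) $ k"
  by (simp add: grad_def matrix_def)

lemma norm_matrix_le:
  fixes M :: "real^'n^'m"
  assumes "\<And>k i. \<bar>M $ k $ i\<bar> \<le> B"
  shows "norm M \<le> of_nat CARD('m) * (of_nat CARD('n) * B)"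
proof -
  have "norm (M $ k) \<le> of_nat CARD('n) * B" for k
  proof -
    have "norm (M $ k) \<le> (\<Sum>i\<in>UNIV. \<bar>M $ k $ i\<bar>)" by (rule norm_le_l1_cart)
    also have "\<dots> \<le> of_nat CARD('n) * B" by (rule sum_bounded_above) (rule assms)
    finally show ?thesis .
  qed
  moreover have "norm M \<le> (\<Sum>k\<in>UNIV. norm (M $ k))"
    unfolding norm_vec_def by (rule L2_set_le_sum) auto
  ultimately show ?thesis
    using sum_bounded_above[of UNIV "\<lambda>k. norm (M $ k)"] order_trans by blast
qed

text \<open>Column \<open>i\<close> of the gradient is the derivative along axis \<open>i\<close>,
  so the bound for a partial derivative applies column by column on the set \<open>S\<close> of
  differentiability points, which fills the cube up to a null set.\<close>

lemma mean_grad: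
  fixes \<Phi> :: "real^'n \<Rightarrow> real^'m"
  assumes lip: "L-lipschitz_on UNIV \<Phi>"
    and ae: "AE x in lebesgue_on unit_cube. \<Phi> differentiable (at x)"
    and face: "\<And>x i. x \<in> cbox (\<chi> j. - 1/2) (\<chi> j. 1/2) \<Longrightarrow> x $ i = - 1/2 \<Longrightarrow> norm (\<Phi> (x + axis i 1) - \<Phi> x) \<le> \<delta>"
  shows "integrable (lebesgue_on unit_cube) (grad \<Phi>)"
    and "\<bar>(LINT x|lebesgue_on unit_cube. grad \<Phi> x) $ k $ i\<bar> \<le> \<delta>"
proof -
  define S where "S = {x \<in> unit_cube. \<Phi> differentiable (at x)}"
  have sub: "S \<subseteq> cbox (\<chi> j. - 1/2) (\<chi> j. 1/2)"
    unfolding S_def closure_unit_cube[symmetric] using closure_subset by auto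
  have neg: "negligible (unit_cube - S)"
  proof -
    have "AE x in lebesgue. x \<in> unit_cube \<longrightarrow> \<Phi> differentiable (at x)"
      using ae by (subst (asm) AE_restrict_space_iff) auto
    then obtain N where "N \<in> null_sets lebesgue" "{x \<in> space lebesgue. \<not> (x \<in> unit_cube \<longrightarrow> \<Phi> differentiable (at x))} \<subseteq> N"
      unfolding eventually_ae_filter by blast
    then show ?thesis
      unfolding negligible_iff_null_sets[symmetric] by (auto intro!: negligible_subset[of N] simp: S_def)
  qed
  have "negligible (cbox (\<chi> j. - 1/2) (\<chi> j. 1/2) - unit_cube :: (real^'n) set)"
    unfolding unit_cube_def by (rule negligible_frontier_interval)
  with neg have neg': "negligible (cbox (\<chi> j. - 1/2) (\<chi> j. 1/2) - S)"
    by (rule negligible_subset[OF negligible_Un]) auto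
  have D: "((\<lambda>h. (\<Phi> (x + h *\<^sub>R axis i 1) - \<Phi> x) /\<^sub>R h) \<longlongrightarrow> column i (grad \<Phi> x)) (at_right 0)"
    if "x \<in> S" for x i
  proof -
    have d: "\<Phi> differentiable (at x)" using that by (simp add: S_def)
    have "column i (grad \<Phi> x) = frechet_derivative \<Phi> (at x) (axis i 1)"
      by (simp add: vec_eq_iff column_def grad_nth[OF d])
    with has_derivative_directional_limit[OF d[unfolded frechet_derivative_works], of "axis i 1"]
    show ?thesis by simp
  qed
  have col: "(\<lambda>x. column i (grad \<Phi> x)) integrable_on S" "norm (integral S (\<lambda>x. column i (grad \<Phi> x))) \<le> \<delta>"
    "x \<in> S \<Longrightarrow> norm (column i (grad \<Phi> x)) \<le> L" for i x
    using mean_partial_derivative_bound[where D="\<lambda>x. column i (grad \<Phi> x)" and i=i and \<delta>=\<delta>, OF lip sub neg'] D face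
    by blast+
  have entry: "(\<lambda>x. grad \<Phi> x $ k $ i) integrable_on S"
    "integral S (\<lambda>x. grad \<Phi> x $ k $ i) = integral S (\<lambda>x. column i (grad \<Phi> x)) $ k" for k i
  proof -
    have "(\<lambda>x. column i (grad \<Phi> x) $ k) integrable_on S"
      using integrable_linear[OF col(1) bounded_linear_vec_nth] by (simp add: o_def)
    then show "(\<lambda>x. grad \<Phi> x $ k $ i) integrable_on S" by (simp add: column_def)
    show "integral S (\<lambda>x. grad \<Phi> x $ k $ i) = integral S (\<lambda>x. column i (grad \<Phi> x)) $ k"
      using integral_component_eq_cart[OF col(1)[of i], of k] by (simp add: column_def)
  qed
  have gi: "grad \<Phi> integrable_on S"
  proof (subst integrable_componentwise_iff, intro ballI)
    fix b :: "real^'n^'m" assume "b \<in> Basis"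
    then obtain k i where "b = axis k (axis i 1)" by (auto simp: Basis_vec_def)
    then show "(\<lambda>x. grad \<Phi> x \<bullet> b) integrable_on S" using entry by (simp add: inner_axis)
  qed
  have L: "0 \<le> L" using lip lipschitz_on_nonneg by blast
  have gb: "norm (grad \<Phi> x) \<le> of_nat CARD('m) * (of_nat CARD('n) * L)" if "x \<in> S" for x
  proof (rule norm_matrix_le)
    fix k i show "\<bar>grad \<Phi> x $ k $ i\<bar> \<le> L"
      using component_le_norm_cart[of "column i (grad \<Phi> x)" k] col(3)[OF that, of i] by (simp add: column_def)
  qed
  have cS: "(\<lambda>x. of_nat CARD('m) * (of_nat CARD('n) * L)) integrable_on S"
    by (rule iffD2[OF integrable_spike_set_eq integrable_const[of _ "\<chi> j. - 1/2" "\<chi> j. 1/2"]])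
      (use sub neg' in \<open>auto simp: Diff_eq_empty_iff[THEN iffD2]\<close>)
  have ai: "set_integrable lebesgue S (grad \<Phi>)"
    by (rule absolutely_integrable_integrable_bound[OF gb gi cS])
  \<comment> \<open>\<open>grad\<close> is 0 by definition at the points of the cube outside
    \<open>S\<close>, so integrals over the cube and over \<open>S\<close> agree.\<close>
  have ind: "(\<lambda>x. indicat_real unit_cube x *\<^sub>R grad \<Phi> x) = (\<lambda>x. indicat_real S x *\<^sub>R grad \<Phi> x)"
    by (auto simp: fun_eq_iff S_def grad_def indicator_def)
  show int: "integrable (lebesgue_on unit_cube) (grad \<Phi>)"
    using ai by (subst integrable_restrict_space) (auto simp: ind set_integrable_def)
  have "(LINT x|lebesgue_on unit_cube. grad \<Phi> x) = (LINT x:S|lebesgue. grad \<Phi> x)"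
    by (subst integral_restrict_space) (auto simp: ind set_lebesgue_integral_def)
  also have "\<dots> = integral S (grad \<Phi>)"
    by (rule set_lebesgue_integral_eq_integral(2)[OF ai])
  finally have eq: "(LINT x|lebesgue_on unit_cube. grad \<Phi> x) = integral S (grad \<Phi>)" .
  have "integral S (grad \<Phi>) $ k $ i = integral S (\<lambda>x. column i (grad \<Phi> x)) $ k"
    unfolding entry(2)[symmetric] using integral_linear[OF gi bounded_linear_compose[OF bounded_linear_vec_nth[of i] bounded_linear_vec_nth[of k]]]
    by (simp add: o_def)
  then show "\<bar>(LINT x|lebesgue_on unit_cube. grad \<Phi> x) $ k $ i\<bar> \<le> \<delta>"
    unfolding eq using component_le_norm_cart[of "integral S (\<lambda>x. column i (grad \<Phi> x))" k] col(2)[of i] by simp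
qed

section \<open>From level convexity to the Morrey conditions\<close>

text \<open>The threshold is an extended real because an essential supremum will take its place. The
  weights 0 and 1, which level convexity leaves out, are treated apart.\<close>

lemma level_convex_sublevel: "level_convex f \<Longrightarrow> convex {y. ereal (f y) \<le> c}"
  unfolding convex_alt level_convex_on_def
proof (clarsimp, goal_cases)
  case (1 x y u)
  show ?case
  proof (cases "u = 0 \<or> u = 1")
    case False
    then have "f (u *\<^sub>R y + (1 - u) *\<^sub>R x) \<le> max (f y) (f x)" using 1 by auto
    then have "ereal (f ((1 - u) *\<^sub>R x + u *\<^sub>R y)) \<le> ereal (max (f y) (f x))"
      by (simp only: add.commute[of "(1 - u) *\<^sub>R x"] ereal_less_eq)
    also have "\<dots> \<le> c" using 1 by (simp add: max_def)
    finally show ?thesis .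
  qed (use 1 in auto)
qed

text \<open>Rademacher's theorem is not needed: where \<open>\<Phi>\<close> fails to be differentiable, \<open>grad \<Phi>\<close> is \<open>0\<close>
  by convention, so that such points contribute the value \<open>f \<xi>\<close> itself to the essential supremum.\<close>

lemma level_convex_mean_grad:
  fixes \<Phi> :: "real^'n \<Rightarrow> real^'m"
  assumes lc: "level_convex f" and lip: "L-lipschitz_on UNIV \<Phi>"
    and face: "\<And>x i. x \<in> cbox (\<chi> j. - 1/2) (\<chi> j. 1/2) \<Longrightarrow> x $ i = - 1/2 \<Longrightarrow> norm (\<Phi> (x + axis i 1) - \<Phi> x) \<le> \<delta>"
    and less: "ess_sup_Q (\<lambda>x. f (\<xi> + grad \<Phi> x)) < ereal (f \<xi>)"
  shows "\<exists>M. ereal (f (\<xi> + M)) \<le> ess_sup_Q (\<lambda>x. f (\<xi> + grad \<Phi> x)) \<and> (\<forall>k i. \<bar>M $ k $ i\<bar> \<le> \<delta>)"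
proof -
  interpret prob_space "lebesgue_on (unit_cube :: (real^'n) set)" by (rule prob_space_unit_cube)
  let ?c = "ess_sup_Q (\<lambda>x. f (\<xi> + grad \<Phi> x))"
  have le: "AE x in lebesgue_on unit_cube. ereal (f (\<xi> + grad \<Phi> x)) \<le> ?c"
    unfolding ess_sup_Q_def by (rule esssup_AE)
  then have "AE x in lebesgue_on unit_cube. \<Phi> differentiable (at x)"
  proof eventually_elim
    case (elim x)
    then have "grad \<Phi> x \<noteq> 0" using less by (metis add.right_neutral leD)
    then show ?case by (auto simp: grad_def split: if_splits)
  qed
  note mg = mean_grad[OF lip this face]
  let ?M = "LINT x|lebesgue_on unit_cube. grad \<Phi> x"
  have "AE x in lebesgue_on unit_cube. \<xi> + grad \<Phi> x \<in> {y. ereal (f y) \<le> ?c}" using le by simp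
  moreover have "integrable (lebesgue_on unit_cube) (\<lambda>x. \<xi> + grad \<Phi> x)" using mg(1) by simp
  ultimately have "(LINT x|lebesgue_on unit_cube. \<xi> + grad \<Phi> x) \<in> {y. ereal (f y) \<le> ?c}"
    using integral_in_convex[OF level_convex_sublevel[OF lc]] by blast
  moreover have "(LINT x|lebesgue_on unit_cube. \<xi> + grad \<Phi> x) = \<xi> + ?M"
    using mg(1) by (simp only: Bochner_Integration.integral_add integrable_const lebesgue_integral_const prob_space scaleR_one)
  ultimately show ?thesis using mg(2) by auto
qed

text \<open>Equal values on opposite faces admit the error 0, and an entrywise bound by 0 leaves
  only \<open>M = 0\<close>, which puts \<open>f \<xi>\<close> itself below the essential
  supremum.\<close>

lemma level_convex_imp_ess_sup:
  fixes \<Phi> :: "real^'n \<Rightarrow> real^'m"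
  assumes "level_convex f" "L-lipschitz_on UNIV \<Phi>"
    and "\<And>x i. x \<in> cbox (\<chi> j. - 1/2) (\<chi> j. 1/2) \<Longrightarrow> x $ i = - 1/2 \<Longrightarrow> \<Phi> (x + axis i 1) = \<Phi> x"
  shows "ereal (f \<xi>) \<le> ess_sup_Q (\<lambda>x. f (\<xi> + grad \<Phi> x))"
proof (rule ccontr)
  assume "\<not> ?thesis"
  then obtain M where M: "ereal (f (\<xi> + M)) \<le> ess_sup_Q (\<lambda>x. f (\<xi> + grad \<Phi> x))" "\<forall>k i. \<bar>M $ k $ i\<bar> \<le> 0"
    using level_convex_mean_grad[OF assms(1,2), of 0 \<xi>] assms(3) by (auto simp: not_le)
  then have "M = 0" by (simp add: vec_eq_iff)
  with M(1) \<open>\<not> ?thesis\<close> show False by simp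
qed

lemma level_convex_imp_periodic_weak_morrey:
  fixes f :: "real^'n^'m \<Rightarrow> real"
  assumes "level_convex f" shows "periodic_weak_morrey_qc f"
  unfolding periodic_weak_morrey_qc_def W1inf_per_def
  using level_convex_imp_ess_sup[OF assms] by blast

lemma level_convex_imp_weak_morrey:
  fixes f :: "real^'n^'m \<Rightarrow> real"
  assumes "level_convex f" shows "weak_morrey_qc f"
  unfolding weak_morrey_qc_def
proof (intro allI impI)
  fix \<xi> and \<phi> :: "real^'n \<Rightarrow> real^'m" assume "\<phi> \<in> W1inf0_Q"
  then obtain C where C: "C-lipschitz_on UNIV \<phi>" and 0: "\<And>x. x \<notin> unit_cube \<Longrightarrow> \<phi> x = 0"
    by (auto simp: W1inf0_Q_def)
  show "ereal (f \<xi>) \<le> ess_sup_Q (\<lambda>x. f (\<xi> + grad \<phi> x))"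
  proof (rule level_convex_imp_ess_sup[OF assms C])
    fix x :: "real^'n" and i assume "x $ i = - 1/2"
    then have "x \<notin> unit_cube" "x + axis i 1 \<notin> unit_cube"
      by (auto simp: mem_unit_cube intro!: exI[of _ i])
    then show "\<phi> (x + axis i 1) = \<phi> x" by (simp add: 0)
  qed
qed

lemma grad_cong_open:
  assumes "open U" "x \<in> U" "\<And>y. y \<in> U \<Longrightarrow> \<phi> y = \<psi> y"
  shows "grad \<phi> x = grad \<psi> x"
proof -
  have d: "(\<phi> has_derivative D) (at x) \<longleftrightarrow> (\<psi> has_derivative D) (at x)" for D
    using has_derivative_transform_within_open[of _ D x UNIV U] assms by (metis (no_types, lifting))
  then have "\<phi> differentiable (at x) \<longleftrightarrow> \<psi> differentiable (at x)"
    by (auto simp: differentiable_def)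
  moreover have "frechet_derivative \<phi> (at x) = frechet_derivative \<psi> (at x)"
    by (simp add: frechet_derivative_def d)
  ultimately show ?thesis by (simp add: grad_def)
qed

lemma ess_sup_Q_cong:
  "(\<And>x. x \<in> unit_cube \<Longrightarrow> h x = k x) \<Longrightarrow> ess_sup_Q h = ess_sup_Q k"
proof -
  assume hk: "\<And>x. x \<in> unit_cube \<Longrightarrow> h x = k x"
  \<comment> \<open>\<open>esssup\<close> is top on non-measurable functions, so measurability has
    to be transferred along with the values.\<close>
  have *: "(\<lambda>x. ereal (h x)) \<in> borel_measurable (lebesgue_on unit_cube) \<longleftrightarrow> (\<lambda>x. ereal (k x)) \<in> borel_measurable (lebesgue_on unit_cube)"
    by (rule measurable_cong) (simp add: hk space_restrict_space)
  have "AE x in lebesgue_on unit_cube. ereal (h x) = ereal (k x)"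
    by (rule AE_I2) (simp add: hk space_restrict_space)
  then show ?thesis
    unfolding ess_sup_Q_def using * esssup_AE_cong esssup_non_measurable by metis
qed

lemma lsc_closed_sublevel: "lsc f \<Longrightarrow> closed {x. f x \<le> c}"
proof -
  assume l: "lsc f"
  have "\<exists>T. open T \<and> x \<in> T \<and> T \<subseteq> {x. c < f x}" if "c < f x" for x
  proof -
    have "\<forall>\<^sub>F y in at x. f x - (f x - c) < f y" using l that unfolding lsc_def by (metis diff_gt_0_iff_gt)
    then have "\<forall>\<^sub>F y in nhds x. c < f y" unfolding eventually_at_filter
      by (rule eventually_mono) (use that in auto)
    then show ?thesis unfolding eventually_nhds by blast
  qed
  then have "open {x. c < f x}" by (subst open_subopen) blast
  moreover have "{x. f x \<le> c} = - {x. c < f x}" by auto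
  ultimately show ?thesis by (simp add: closed_def)
qed

text \<open>The mean of \<open>\<xi> + grad \<phi>\<close> is now only close to
  \<open>\<xi>\<close>. Lower semicontinuity closes the sublevel set at
  \<open>f \<xi> - \<epsilon>\<close>, so a ball about \<open>\<xi>\<close> misses it, and boundary
  values small against the radius keep the mean in that ball.\<close>

lemma level_convex_imp_strong_morrey:
  fixes f :: "real^'n^'m \<Rightarrow> real"
  assumes lc: "level_convex f" and "lsc f" shows "strong_morrey_qc f"
  unfolding strong_morrey_qc_def
proof (intro allI impI)
  fix \<epsilon> K :: real and \<xi> :: "real^'n^'m" assume e: "0 < \<epsilon>"
  let ?C = "{y. f y \<le> f \<xi> - \<epsilon>}" and ?Q = "cbox (\<chi> j. - 1/2) (\<chi> j. 1/2) :: (real^'n) set"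
  have "open (- ?C)" using lsc_closed_sublevel[OF \<open>lsc f\<close>] by (simp add: open_Compl)
  then obtain r where r: "r > 0" "ball \<xi> r \<subseteq> - ?C"
    using e by (metis (mono_tags, lifting) ComplI diff_less_eq less_add_same_cancel1 linorder_not_less mem_Collect_eq openE)
  \<comment> \<open>The mean perturbation will have entries at most \<open>2 * d\<close>, one
    \<open>d\<close> from each of two opposite faces, hence norm at most
    \<open>r / 2\<close>.\<close>
  define d where "d = r / (4 * of_nat CARD('m) * of_nat CARD('n))"
  have d: "d > 0" using r by (simp add: d_def)
  show "\<exists>\<delta>>0. \<forall>\<phi>. \<phi> \<in> W1inf_Q \<and> ess_sup_Q (\<lambda>x. norm (grad \<phi> x)) \<le> ereal K \<and> (\<forall>x\<in>frontier unit_cube. norm (\<phi> x) \<le> \<delta>) \<longrightarrow>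
    ereal (f \<xi>) \<le> ess_sup_Q (\<lambda>x. f (\<xi> + grad \<phi> x)) + ereal \<epsilon>"
  proof (intro exI conjI allI impI, rule d, elim conjE)
    fix \<phi> :: "real^'n \<Rightarrow> real^'m"
    assume "\<phi> \<in> W1inf_Q" and small: "\<forall>x\<in>frontier unit_cube. norm (\<phi> x) \<le> d"
    then obtain L where L: "L-lipschitz_on ?Q \<phi>" by (auto simp: W1inf_Q_def closure_unit_cube)
    \<comment> \<open>\<open>\<phi>\<close> is controlled only on the closed cube, whereas the mean
      estimate reaches beyond it. Composing with the nearest-point projection, which is 1-Lipschitz,
      extends \<open>\<phi>\<close> and keeps its gradient in the open cube.\<close>
    define P where "P = closest_point ?Q"
    have Qne: "?Q \<noteq> {}" by (auto simp: interval_eq_empty_cart not_less)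
    have PQ: "P x \<in> ?Q" for x unfolding P_def by (rule closest_point_in_set) (use Qne in auto)
    have P1: "1-lipschitz_on UNIV P" unfolding P_def
      by (rule lipschitz_onI) (use closest_point_lipschitz[of ?Q] Qne in \<open>auto simp: convex_box\<close>)
    have Pid: "P x = x" if "x \<in> ?Q" for x unfolding P_def using that by (rule closest_point_self)
    define \<Phi> where "\<Phi> x = \<phi> (P x)" for x
    have lip: "(1 * L)-lipschitz_on UNIV \<Phi>" 
      unfolding \<Phi>_def mult.commute[of 1 L] by (rule lipschitz_on_compose2[OF P1]) (rule lipschitz_on_subset[OF L], use PQ in auto)
    have fr: "frontier unit_cube = ?Q - unit_cube"
      by (simp add: frontier_def closure_unit_cube interior_open open_unit_cube)
    have gr: "grad \<Phi> x = grad \<phi> x" if "x \<in> unit_cube" for x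
    proof (rule grad_cong_open[OF open_unit_cube that])
      fix y :: "real^'n" assume "y \<in> unit_cube"
      then have "y \<in> ?Q" unfolding closure_unit_cube[symmetric] using closure_subset by blast
      then show "\<Phi> y = \<phi> y" by (simp add: \<Phi>_def Pid)
    qed
    have ess: "ess_sup_Q (\<lambda>x. f (\<xi> + grad \<Phi> x)) = ess_sup_Q (\<lambda>x. f (\<xi> + grad \<phi> x))"
      by (rule ess_sup_Q_cong) (simp add: gr)
    have face: "norm (\<Phi> (x + axis i 1) - \<Phi> x) \<le> 2 * d" if x: "x \<in> ?Q" "x $ i = - 1/2" for x i
    proof -
      have "x + axis i 1 \<in> ?Q" using x unfolding mem_box_cart by (auto simp: axis_def)
      moreover have "x \<notin> unit_cube" "x + axis i 1 \<notin> unit_cube"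
        using x by (auto simp: mem_unit_cube intro!: exI[of _ i])
      ultimately have "norm (\<Phi> (x + axis i 1)) \<le> d" "norm (\<Phi> x) \<le> d"
        using small x unfolding fr \<Phi>_def by (auto simp: Pid)
      then show ?thesis using norm_triangle_ineq4[of "\<Phi> (x + axis i 1)" "\<Phi> x"] by linarith
    qed
    show "ereal (f \<xi>) \<le> ess_sup_Q (\<lambda>x. f (\<xi> + grad \<phi> x)) + ereal \<epsilon>"
    proof (rule ccontr)
      assume "\<not> ?thesis"
      then have lt: "ess_sup_Q (\<lambda>x. f (\<xi> + grad \<Phi> x)) < ereal (f \<xi> - \<epsilon>)"
        unfolding ess by (cases "ess_sup_Q (\<lambda>x. f (\<xi> + grad \<phi> x))") auto
      then have lt': "ess_sup_Q (\<lambda>x. f (\<xi> + grad \<Phi> x)) < ereal (f \<xi>)"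
        by (rule less_le_trans) (use e in simp)
      obtain M where M: "ereal (f (\<xi> + M)) \<le> ess_sup_Q (\<lambda>x. f (\<xi> + grad \<Phi> x))" "\<And>k i. \<bar>M $ k $ i\<bar> \<le> 2 * d"
        using level_convex_mean_grad[OF lc lip face lt'] by blast
      from order.strict_trans1[OF M(1) lt] have "\<xi> + M \<in> ?C" by simp
      with r(2) have "\<xi> + M \<notin> ball \<xi> r" by blast
      then have "r \<le> norm M" by (simp add: dist_norm)
      also have "norm M \<le> of_nat CARD('m) * (of_nat CARD('n) * (2 * d))"
        by (rule norm_matrix_le) (rule M(2))
      also have "\<dots> < r" using r by (simp add: d_def)
      finally show False by simp
    qed
  qed
qed

section \<open>Piecewise affine test functions\<close>

text \<open>Two different affine functions agree at most on a hyperplane, so the coincidences of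
  countably many pieces form a null set \<open>N\<close>. Off \<open>N\<close> a single piece takes
  the value \<open>u x\<close>; the finitely many others in \<open>F\<close> differ from
  \<open>u\<close> at \<open>x\<close>, by continuity also nearby, so one piece describes
  \<open>u\<close> on a whole neighbourhood.\<close>

lemma piecewise_affine_ae:
  fixes u :: "'a::euclidean_space \<Rightarrow> real" and A :: "('a \<times> real) set"
  assumes U: "open U" and cont: "continuous_on U u" and A: "countable A"
    and loc: "\<And>x. x \<in> U \<Longrightarrow> \<exists>e>0. \<exists>F\<subseteq>A. finite F \<and> (\<forall>y\<in>ball x e. \<exists>(p, c)\<in>F. u y = p \<bullet> y + c)"
  obtains G where "open G" "G \<subseteq> U" "negligible (U - G)"
    "\<And>x. x \<in> G \<Longrightarrow> \<exists>(p, c)\<in>A. \<exists>e>0. \<forall>y\<in>ball x e. y \<in> G \<and> u y = p \<bullet> y + c"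
proof -
  define G where "G = (\<Union>(p, c)\<in>A. interior {y \<in> U. u y = p \<bullet> y + c})"
  define N where "N = (\<Union>(q, q')\<in>{(q, q'). q \<in> A \<and> q' \<in> A \<and> q \<noteq> q'}. {x. (fst q - fst q') \<bullet> x = snd q' - snd q})"
  have "open G" unfolding G_def by (auto intro!: open_UN)
  have "G \<subseteq> U" unfolding G_def using interior_subset by fastforce
  have "countable {(q, q'). q \<in> A \<and> q' \<in> A \<and> q \<noteq> q'}"
    by (rule countable_subset[OF _ countable_SIGMA[OF A A]]) auto
  then have "negligible N" unfolding N_def
  proof (rule negligible_countable_Union[OF countable_image])
    fix S assume "S \<in> (\<lambda>(q, q'). {x. (fst q - fst q') \<bullet> x = snd q' - snd q}) ` {(q, q'). q \<in> A \<and> q' \<in> A \<and> q \<noteq> q'}"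
    then obtain q q' where q: "q \<noteq> q'" "S = {x. (fst q - fst q') \<bullet> x = snd q' - snd q}" by auto
    then have "fst q - fst q' \<noteq> 0 \<or> snd q' - snd q \<noteq> 0" by (auto simp: prod_eq_iff)
    then show "negligible S" unfolding q(2) by (rule negligible_hyperplane)
  qed
  have "U - G \<subseteq> N"
  proof
    fix x assume x: "x \<in> U - G"
    show "x \<in> N"
    proof (rule ccontr)
      assume xN: "x \<notin> N"
      obtain e F where e: "e > 0" "F \<subseteq> A" "finite F" "\<And>y. y \<in> ball x e \<Longrightarrow> \<exists>(p, c)\<in>F. u y = p \<bullet> y + c"
        using loc[of x] x by auto
      obtain p c where pc: "(p, c) \<in> F" "u x = p \<bullet> x + c" using e(4)[of x] e(1) by auto
      have cu: "(u \<longlongrightarrow> u x) (nhds x)"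
        using cont U x by (metis DiffD1 continuous_on_eq_continuous_at isCont_def tendsto_at_iff_tendsto_nhds)
      have "\<forall>\<^sub>F y in nhds x. u y \<noteq> fst q \<bullet> y + snd q" if q: "q \<in> F - {(p, c)}" for q
      proof -
        have ne: "u x \<noteq> fst q \<bullet> x + snd q"
        proof
          assume "u x = fst q \<bullet> x + snd q"
          then have "(fst q - fst (p, c)) \<bullet> x = snd (p, c) - snd q" using pc by (simp add: inner_diff_left)
          then have "x \<in> N" unfolding N_def using q pc e(2) by (intro UN_I[of "(q, (p, c))"]) auto
          then show False using xN by simp
        qed
        have lim: "((\<lambda>y. u y - (fst q \<bullet> y + snd q)) \<longlongrightarrow> u x - (fst q \<bullet> x + snd q)) (nhds x)"
          by (intro tendsto_intros cu) (simp_all add: filterlim_ident)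
        have "\<forall>\<^sub>F y in nhds x. u y - (fst q \<bullet> y + snd q) \<noteq> 0"
          by (rule tendsto_imp_eventually_ne[OF lim]) (use ne in simp)
        then show ?thesis by (rule eventually_mono) auto
      qed
      then have "\<forall>\<^sub>F y in nhds x. \<forall>q\<in>F - {(p, c)}. u y \<noteq> fst q \<bullet> y + snd q"
        using e(3) by (intro eventually_ball_finite) auto
      moreover have "\<forall>\<^sub>F y in nhds x. y \<in> ball x e" using e(1) by (intro eventually_nhds_in_open) auto
      moreover have "\<forall>\<^sub>F y in nhds x. y \<in> U" using U x by (intro eventually_nhds_in_open) auto
      ultimately have "\<forall>\<^sub>F y in nhds x. y \<in> U \<and> u y = p \<bullet> y + c"
      proof eventually_elim
        case (elim y)
        then obtain q where "q \<in> F" "u y = fst q \<bullet> y + snd q" using e(4)[of y] by force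
        with elim show ?case by (cases "q = (p, c)") auto
      qed
      then have "x \<in> interior {y \<in> U. u y = p \<bullet> y + c}"
        by (auto simp: eventually_nhds interior_def)
      then have "x \<in> G" using pc e(2) by (auto simp: G_def)
      then show False using x by simp
    qed
  qed
  then have "negligible (U - G)" using \<open>negligible N\<close> negligible_subset by blast
  moreover have "\<exists>(p, c)\<in>A. \<exists>e>0. \<forall>y\<in>ball x e. y \<in> G \<and> u y = p \<bullet> y + c" if xG: "x \<in> G" for x
  proof -
    obtain p c where pc: "(p, c) \<in> A" "x \<in> interior {y \<in> U. u y = p \<bullet> y + c}"
      using xG by (auto simp: G_def)
    then obtain e where "e > 0" "ball x e \<subseteq> interior {y \<in> U. u y = p \<bullet> y + c}"
      using open_contains_ball open_interior by blast
    moreover have "interior {y \<in> U. u y = p \<bullet> y + c} \<subseteq> G" using pc(1) by (auto simp: G_def)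
    moreover have "interior {y \<in> U. u y = p \<bullet> y + c} \<subseteq> {y. u y = p \<bullet> y + c}" using interior_subset by blast
    ultimately show ?thesis using pc(1) by blast
  qed
  ultimately show thesis using that \<open>open G\<close> \<open>G \<subseteq> U\<close> by blast
qed

definition outer_product :: "real^'m \<Rightarrow> real^'n \<Rightarrow> real^'n^'m" where
  "outer_product a p = (\<chi> i j. a $ i * p $ j)"

lemma outer_product_add: "outer_product a (p + q) = outer_product a p + outer_product a q"
  and outer_product_scale: "outer_product a (t *\<^sub>R p) = t *\<^sub>R outer_product a p"
  by (simp_all add: outer_product_def vec_eq_iff distrib_left)

lemma outer_product_zero [simp]: "outer_product a 0 = 0"
  by (simp add: outer_product_def vec_eq_iff)

lemma grad_locally_affine:
  assumes e: "e > 0" and u: "\<And>y. y \<in> ball x e \<Longrightarrow> u y = p \<bullet> y + c"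
  shows "grad (\<lambda>x. u x *\<^sub>R a) x = outer_product a p"
proof -
  let ?\<psi> = "\<lambda>y. (p \<bullet> y + c) *\<^sub>R a"
  have "grad (\<lambda>x. u x *\<^sub>R a) x = grad ?\<psi> x"
    by (rule grad_cong_open[of "ball x e"]) (use e u in auto)
  have d: "(?\<psi> has_derivative (\<lambda>v. (p \<bullet> v) *\<^sub>R a)) (at x)"
    by (auto intro!: derivative_eq_intros)
  then have "?\<psi> differentiable (at x)" by (auto simp: differentiable_def)
  moreover have "frechet_derivative ?\<psi> (at x) = (\<lambda>v. (p \<bullet> v) *\<^sub>R a)"
    using frechet_derivative_at[OF d] by simp
  ultimately have "grad ?\<psi> x = outer_product a p"
    by (simp add: vec_eq_iff grad_nth outer_product_def inner_axis)
  then show ?thesis using \<open>grad _ x = grad ?\<psi> x\<close> by simp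
qed

text \<open>\<open>h\<close> is arbitrary, so measurability has to come from the gradient: on the
  open set \<open>G\<close> it is locally constant, which makes preimages within \<open>G\<close>
  open, and the rest of the cube is null. On \<open>G\<close> only slopes listed in \<open>A\<close>
  occur.\<close>

lemma ess_sup_Q_piecewise_affine:
  fixes u :: "real^'n \<Rightarrow> real" and a :: "real^'m" and h :: "real^'n^'m \<Rightarrow> real"
  assumes cont: "continuous_on unit_cube u" and A: "countable A"
    and loc: "\<And>x. x \<in> unit_cube \<Longrightarrow> \<exists>e>0. \<exists>F\<subseteq>A. finite F \<and> (\<forall>y\<in>ball x e. \<exists>(p, c)\<in>F. u y = p \<bullet> y + c)"
    and bound: "\<And>p c. (p, c) \<in> A \<Longrightarrow> h (outer_product a p) \<le> C"
  shows "ess_sup_Q (\<lambda>x. h (grad (\<lambda>x. u x *\<^sub>R a) x)) \<le> ereal C"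
proof -
  let ?H = "\<lambda>x. ereal (h (grad (\<lambda>x. u x *\<^sub>R a) x))"
  obtain G where G: "open G" "G \<subseteq> unit_cube" "negligible (unit_cube - G)"
    "\<And>x. x \<in> G \<Longrightarrow> \<exists>(p, c)\<in>A. \<exists>e>0. \<forall>y\<in>ball x e. y \<in> G \<and> u y = p \<bullet> y + c"
    by (rule piecewise_affine_ae[OF open_unit_cube cont A loc]) (assumption, rule that)
  have locH: "\<exists>p c e. (p, c) \<in> A \<and> e > 0 \<and> ball x e \<subseteq> G \<and> (\<forall>y\<in>ball x e. ?H y = ereal (h (outer_product a p)))"
    if x: "x \<in> G" for x
  proof -
    obtain p c e where e: "(p, c) \<in> A" "e > 0" "\<forall>y\<in>ball x e. y \<in> G \<and> u y = p \<bullet> y + c"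
      using G(4)[OF x] by blast
    have "grad (\<lambda>x. u x *\<^sub>R a) y = outer_product a p" if y: "y \<in> ball x e" for y
    proof -
      obtain d where "d > 0" "ball y d \<subseteq> ball x e" by (rule openE[OF open_ball y])
      then show ?thesis using e(3) by (intro grad_locally_affine[of d]) auto
    qed
    then have H: "\<forall>y\<in>ball x e. ?H y = ereal (h (outer_product a p))" by simp
    have "ball x e \<subseteq> G" using e(3) by blast
    with e(1,2) H show ?thesis by (intro exI conjI)
  qed
  have "open {x \<in> G. ?H x \<in> B}" for B
  proof (subst open_contains_ball, safe)
    fix x assume x: "x \<in> G" "?H x \<in> B"
    from locH[OF x(1)] obtain p e where e: "e > 0" "ball x e \<subseteq> G" "\<forall>y\<in>ball x e. ?H y = ereal (h (outer_product a p))"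
      by blast
    have "?H y \<in> B" if "y \<in> ball x e" for y
    proof -
      have "x \<in> ball x e" using e(1) by simp
      then have "?H y = ?H x" using e(3) that by metis
      then show ?thesis using x(2) by metis
    qed
    then show "\<exists>e>0. ball x e \<subseteq> {x \<in> G. ?H x \<in> B}" using e(1,2) by blast
  qed
  moreover have "{x \<in> unit_cube - G. ?H x \<in> B} \<in> sets lebesgue" for B
    by (rule negligible_imp_sets, rule negligible_subset[OF G(3)]) auto
  ultimately have "{x \<in> G. ?H x \<in> B} \<union> {x \<in> unit_cube - G. ?H x \<in> B} \<in> sets lebesgue" for B
    by (intro sets.Un) auto
  moreover have "{x \<in> G. ?H x \<in> B} \<union> {x \<in> unit_cube - G. ?H x \<in> B} = ?H -` B \<inter> unit_cube" for B
    using G(2) by auto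
  ultimately have m: "?H -` B \<inter> unit_cube \<in> sets lebesgue" for B by metis
  have "?H \<in> borel_measurable (lebesgue_on unit_cube)"
    using m by (intro measurableI) (auto simp: sets_restrict_space_iff space_restrict_space)
  moreover have "AE x in lebesgue_on unit_cube. ?H x \<le> ereal C"
  proof (subst AE_restrict_space_iff)
    have "?H x \<le> ereal C" if "x \<in> G" for x
    proof -
      from locH[OF that] obtain p c e where "(p, c) \<in> A" "e > 0" "\<forall>y\<in>ball x e. ?H y = ereal (h (outer_product a p))"
        by blast
      moreover from this have "?H x = ereal (h (outer_product a p))" by (meson centre_in_ball)
      ultimately show ?thesis using bound[of p c] by simp
    qed
    then show "AE x in lebesgue. x \<in> unit_cube \<longrightarrow> ?H x \<le> ereal C"
      using G(3) unfolding negligible_iff_null_sets by (intro AE_I'[of "unit_cube - G"]) auto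
  qed auto
  ultimately show ?thesis unfolding ess_sup_Q_def by (rule esssup_I)
qed

text \<open>Nonnegativity bounds the family from below, so that the real infimum is a genuine
  one.\<close>

lemma lipschitz_on_INF:
  fixes g :: "'i \<Rightarrow> 'a::metric_space \<Rightarrow> real"
  assumes "I \<noteq> {}" and lip: "\<And>i. i \<in> I \<Longrightarrow> L-lipschitz_on X (g i)" and nonneg: "\<And>i x. i \<in> I \<Longrightarrow> 0 \<le> g i x"
  shows "L-lipschitz_on X (\<lambda>x. INF i\<in>I. g i x)"
proof -
  have *: "(INF i\<in>I. g i x) - (INF i\<in>I. g i y) \<le> L * dist x y" if "x \<in> X" "y \<in> X" for x y
  proof -
    have "(INF i\<in>I. g i x) - L * dist x y \<le> (INF i\<in>I. g i y)"
    proof (rule cINF_greatest[OF \<open>I \<noteq> {}\<close>])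
      fix i assume i: "i \<in> I"
      have "(INF i\<in>I. g i x) \<le> g i x"
        by (rule cINF_lower[OF _ i]) (use nonneg in \<open>auto intro!: bdd_belowI[of _ 0]\<close>)
      moreover have "\<bar>g i x - g i y\<bar> \<le> L * dist x y"
        using lipschitz_onD[OF lip[OF i] that] by (simp add: dist_real_def)
      ultimately show "(INF i\<in>I. g i x) - L * dist x y \<le> g i y" by linarith
    qed
    then show ?thesis by linarith
  qed
  show ?thesis
  proof (rule lipschitz_onI)
    fix x y assume "x \<in> X" "y \<in> X"
    then show "dist (INF i\<in>I. g i x) (INF i\<in>I. g i y) \<le> L * dist x y"
      using *[of x y] *[of y x] by (simp add: dist_real_def dist_commute abs_le_iff)
  next
    show "0 \<le> L" using \<open>I \<noteq> {}\<close> lip lipschitz_on_nonneg by blast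
  qed
qed

lemma INF_attained_on_finite:
  fixes g :: "'i \<Rightarrow> real"
  assumes "finite I0" "I0 \<subseteq> I" "i0 \<in> I0" "\<And>i. i \<in> I - I0 \<Longrightarrow> g i0 \<le> g i"
  shows "\<exists>i\<in>I0. (INF i\<in>I. g i) = g i"
proof -
  obtain i where i: "i \<in> I0" "\<And>j. j \<in> I0 \<Longrightarrow> g i \<le> g j"
    using ex_min_if_finite[of "g ` I0"] assms(1,3)
    by (metis (no_types, lifting) arg_min_if_finite(1) arg_min_least empty_iff)
  have "(INF i\<in>I. g i) = g i"
  proof (rule cInf_eq_minimum)
    show "g i \<in> g ` I" using i(1) assms(2) by blast
    fix z assume "z \<in> g ` I"
    then obtain j where j: "j \<in> I" "z = g j" by blast
    show "g i \<le> z"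
    proof (cases "j \<in> I0")
      case False
      then have "g i0 \<le> g j" using assms(4) j by blast
      with i(2)[OF assms(3)] j show ?thesis by simp
    qed (use i(2) j in blast)
  qed
  with i show ?thesis by blast
qed

text \<open>The common interface for plain and branched laminates. By \<open>loc\<close>, near each
  point a fixed finite \<open>I0\<close> contains for every \<open>y\<close> a term undercutting all
  terms outside \<open>I0\<close>; which one may vary with \<open>y\<close>. The infimum is then
  locally a minimum over \<open>I0\<close>, and its gradients are slopes of single terms.\<close>

lemma ess_sup_Q_INF_piecewise_affine:
  fixes g :: "'i \<Rightarrow> real^'n \<Rightarrow> real" and a :: "real^'m" and h :: "real^'n^'m \<Rightarrow> real"
  assumes I: "countable I" "I \<noteq> {}" and lip: "\<And>i. i \<in> I \<Longrightarrow> L-lipschitz_on UNIV (g i)"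
    and nonneg: "\<And>i x. i \<in> I \<Longrightarrow> 0 \<le> g i x"
    and P: "\<And>i. i \<in> I \<Longrightarrow> finite (P i)" "\<And>i x. i \<in> I \<Longrightarrow> \<exists>(p, c)\<in>P i. g i x = p \<bullet> x + c"
    and loc: "\<And>x. x \<in> unit_cube \<Longrightarrow> \<exists>e>0. \<exists>I0\<subseteq>I. finite I0 \<and> (\<forall>y\<in>ball x e. \<exists>i0\<in>I0. \<forall>i\<in>I - I0. g i0 y \<le> g i y)"
    and bound: "\<And>i p c. i \<in> I \<Longrightarrow> (p, c) \<in> P i \<Longrightarrow> h (outer_product a p) \<le> C"
  shows "ess_sup_Q (\<lambda>x. h (grad (\<lambda>x. (INF i\<in>I. g i x) *\<^sub>R a) x)) \<le> ereal C"
proof (rule ess_sup_Q_piecewise_affine[where A = "\<Union>i\<in>I. P i"])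
  show "continuous_on unit_cube (\<lambda>x. INF i\<in>I. g i x)"
    by (rule continuous_on_subset[OF lipschitz_on_continuous_on[OF lipschitz_on_INF[OF I(2) lip nonneg]]]) auto
  show "countable (\<Union>i\<in>I. P i)" using I(1) P(1) by (auto intro: countable_finite)
  show "h (outer_product a p) \<le> C" if "(p, c) \<in> (\<Union>i\<in>I. P i)" for p c using that bound by blast
  fix x :: "real^'n" assume "x \<in> unit_cube"
  from loc[OF this] obtain e I0 where e: "e > 0" "I0 \<subseteq> I" "finite I0"
    "\<And>y. y \<in> ball x e \<Longrightarrow> \<exists>i0\<in>I0. \<forall>i\<in>I - I0. g i0 y \<le> g i y" by blast
  have "\<exists>(p, c)\<in>\<Union>i\<in>I0. P i. (INF i\<in>I. g i y) = p \<bullet> y + c" if "y \<in> ball x e" for y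
  proof -
    from e(4)[OF that] obtain i0 where "i0 \<in> I0" "\<And>i. i \<in> I - I0 \<Longrightarrow> g i0 y \<le> g i y" by blast
    from INF_attained_on_finite[where g="\<lambda>i. g i y", OF e(3,2) this] obtain i where i: "i \<in> I0" "(INF i\<in>I. g i y) = g i y" by blast
    obtain p c where "(p, c) \<in> P i" "g i y = p \<bullet> y + c" using P(2)[of i y] i(1) e(2) by blast
    with i show ?thesis by (intro bexI[of _ "(p, c)"]) auto
  qed
  moreover have "finite (\<Union>i\<in>I0. P i)" using e(2,3) P(1) by blast
  moreover have "(\<Union>i\<in>I0. P i) \<subseteq> (\<Union>i\<in>I. P i)" using e(2) by blast
  ultimately show "\<exists>e>0. \<exists>F\<subseteq>\<Union>i\<in>I. P i. finite F \<and> (\<forall>y\<in>ball x e. \<exists>(p, c)\<in>F. (INF i\<in>I. g i y) = p \<bullet> y + c)"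
    using e(1) by meson
qed

lemma lipschitz_on_scaleR_const:
  fixes u :: "'a::metric_space \<Rightarrow> real" and a :: "'b::real_normed_vector"
  assumes "L-lipschitz_on X u" shows "(L * norm a)-lipschitz_on X (\<lambda>x. u x *\<^sub>R a)"
proof (rule lipschitz_onI)
  show "0 \<le> L * norm a" using lipschitz_on_nonneg[OF assms] by simp
  fix x y assume "x \<in> X" "y \<in> X"
  then have "\<bar>u x - u y\<bar> * norm a \<le> L * dist x y * norm a"
    using lipschitz_onD[OF assms] by (intro mult_right_mono) (auto simp: dist_real_def)
  then show "dist (u x *\<^sub>R a) (u y *\<^sub>R a) \<le> L * norm a * dist x y"
    by (simp add: dist_norm mult_ac flip: scaleR_diff_left)
qed

section \<open>Test functions for the weak conditions\<close>

text \<open>A function supported in the cube serves the zero boundary condition as it stands, and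
  the periodic one after repetition over all integer translates. Inside the cube nothing changes, so
  one construction covers both notions.\<close>

lemma weak_morrey_test:
  fixes f :: "real^'n^'m \<Rightarrow> real" and a :: "real^'m"
  assumes f: "weak_morrey_qc f \<or> periodic_weak_morrey_qc f"
    and lip: "L-lipschitz_on UNIV u" and nonneg: "\<And>x. 0 \<le> u x" and zero: "\<And>x. x \<notin> unit_cube \<Longrightarrow> u x = 0"
  shows "ereal (f \<xi>) \<le> ess_sup_Q (\<lambda>x. f (\<xi> + grad (\<lambda>x. u x *\<^sub>R a) x))"
  using f
proof
  assume "weak_morrey_qc f"
  moreover have "(\<lambda>x. u x *\<^sub>R a) \<in> W1inf0_Q"
    using lipschitz_on_scaleR_const[OF lip] zero by (auto simp: W1inf0_Q_def)
  ultimately show ?thesis by (simp add: weak_morrey_qc_def)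
next
  assume per: "periodic_weak_morrey_qc f"
  \<comment> \<open>Coordinatewise rounding: the centre of the integer translate of the cube that
    contains \<open>x\<close>.\<close>
  define z :: "real^'n \<Rightarrow> real^'n" where "z x = (\<chi> i. of_int \<lfloor>x $ i + 1/2\<rfloor>)" for x
  define w where "w x = u (x - z x)" for x
  \<comment> \<open>A translate of \<open>u\<close> either vanishes at \<open>y\<close> or is the
    one defining \<open>w y\<close>. Comparing \<open>x\<close> and \<open>y\<close> by the
    translate belonging to \<open>x\<close> then gives the Lipschitz bound across faces.\<close>
  have le: "u (y - z x) \<le> w y" for x y
  proof (cases "y - z x \<in> unit_cube")
    case True
    have "\<lfloor>y $ i + 1/2\<rfloor> = \<lfloor>x $ i + 1/2\<rfloor>" for i
    proof (rule floor_unique)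
      have "\<bar>y $ i - of_int \<lfloor>x $ i + 1/2\<rfloor>\<bar> < 1/2" using True by (auto simp: mem_unit_cube z_def)
      then show "of_int \<lfloor>x $ i + 1/2\<rfloor> \<le> y $ i + 1/2" "y $ i + 1/2 < of_int \<lfloor>x $ i + 1/2\<rfloor> + 1" by linarith+
    qed
    then have "z y = z x" by (simp add: z_def)
    then show ?thesis by (simp add: w_def)
  qed (simp add: w_def zero nonneg)
  have "w x - w y \<le> L * dist x y" for x y
  proof -
    have "w x - w y \<le> u (x - z x) - u (y - z x)" using le[where x=x and y=y] by (simp add: w_def)
    also have "\<dots> \<le> L * dist (x - z x) (y - z x)"
      using lipschitz_onD[OF lip, of "x - z x" "y - z x"] by (simp add: dist_real_def)
    finally show ?thesis by (simp add: dist_norm)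
  qed
  then have "\<bar>w x - w y\<bar> \<le> L * dist x y" for x y
    by (metis abs_le_iff dist_commute minus_diff_eq)
  then have wl: "L-lipschitz_on UNIV w"
    using lipschitz_on_nonneg[OF lip] by (intro lipschitz_onI) (auto simp: dist_real_def)
  have "compact (u ` closure unit_cube)"
    unfolding closure_unit_cube using lipschitz_on_continuous_on[OF lip] continuous_on_subset
    by (intro compact_continuous_image) auto
  then have "bounded (u ` closure unit_cube \<union> {0})" by (simp add: compact_imp_bounded)
  moreover have "range w \<subseteq> u ` closure unit_cube \<union> {0}"
    using zero closure_subset[of unit_cube] by (auto simp: w_def)
  ultimately have "bounded (range w)" using bounded_subset by blast
  then have "bounded ((\<lambda>t. t *\<^sub>R a) ` range w)"
    by (rule bounded_linear_image) (rule bounded_linear_scaleR_left)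
  moreover have "w (x + axis i 1) = w x" for x i
  proof -
    have "z (x + axis i 1) = z x + axis i 1"
    proof (subst vec_eq_iff, rule allI)
      fix j
      have "\<lfloor>x $ i + 1 + 1/2\<rfloor> = \<lfloor>x $ i + 1/2\<rfloor> + 1" by linarith
      then show "z (x + axis i 1) $ j = (z x + axis i 1) $ j"
        by (cases "j = i") (simp_all add: z_def axis_def)
    qed
    then show ?thesis by (simp add: w_def)
  qed
  ultimately have "(\<lambda>x. w x *\<^sub>R a) \<in> W1inf_per"
    using lipschitz_on_scaleR_const[OF wl] by (auto simp: W1inf_per_def image_image)
  then have "ereal (f \<xi>) \<le> ess_sup_Q (\<lambda>x. f (\<xi> + grad (\<lambda>x. w x *\<^sub>R a) x))"
    using per by (simp add: periodic_weak_morrey_qc_def)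
  also have "\<dots> = ess_sup_Q (\<lambda>x. f (\<xi> + grad (\<lambda>x. u x *\<^sub>R a) x))"
  proof (rule ess_sup_Q_cong)
    fix x :: "real^'n" assume x: "x \<in> unit_cube"
    have "w y = u y" if "y \<in> unit_cube" for y
    proof -
      have "\<lfloor>y $ i + 1/2\<rfloor> = 0" for i
        using that[unfolded mem_unit_cube, rule_format, of i] by (intro floor_unique) auto
      then have "z y = 0" by (simp add: z_def vec_eq_iff)
      then show ?thesis by (simp add: w_def)
    qed
    then have "grad (\<lambda>x. w x *\<^sub>R a) x = grad (\<lambda>x. u x *\<^sub>R a) x"
      by (intro grad_cong_open[OF open_unit_cube x]) simp
    then show "f (\<xi> + grad (\<lambda>x. w x *\<^sub>R a) x) = f (\<xi> + grad (\<lambda>x. u x *\<^sub>R a) x)" by simp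
  qed
  finally show ?thesis .
qed

section \<open>Sawtooth profiles, laminates and their branching at the boundary\<close>

text \<open>A V-shaped profile. Composed with \<open>b \<bullet> x\<close> it has gradients
  \<open>(1 - l) *\<^sub>R b\<close> and \<open>(- l) *\<^sub>R b\<close>; multiplied by
  \<open>a\<close>, these are the displacements of the end points of a segment from their convex
  combination with weights \<open>l\<close> and \<open>1 - l\<close>.\<close>

definition tooth :: "real \<Rightarrow> real \<Rightarrow> real" where
  "tooth l t = max ((1 - l) * t) (- l * t)"

lemma lipschitz_on_max:
  fixes g h :: "'a::metric_space \<Rightarrow> real"
  assumes "L-lipschitz_on X g" "L-lipschitz_on X h"
  shows "L-lipschitz_on X (\<lambda>x. max (g x) (h x))"
proof (rule lipschitz_onI)
  show "0 \<le> L" using assms(1) by (rule lipschitz_on_nonneg)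
  fix x y assume "x \<in> X" "y \<in> X"
  then have "\<bar>g x - g y\<bar> \<le> L * dist x y" "\<bar>h x - h y\<bar> \<le> L * dist x y"
    using lipschitz_onD[OF assms(1)] lipschitz_onD[OF assms(2)] by (auto simp: dist_real_def)
  then show "dist (max (g x) (h x)) (max (g y) (h y)) \<le> L * dist x y"
    unfolding dist_real_def max_def by (simp split: if_splits; linarith)
qed

lemma lipschitz_on_affine:
  fixes p :: "'a::real_inner"
  assumes "norm p \<le> L" shows "L-lipschitz_on X (\<lambda>x. p \<bullet> x + c)"
proof (rule lipschitz_onI)
  show "0 \<le> L" using assms norm_ge_zero order_trans by blast
  fix x y :: 'a
  have "\<bar>p \<bullet> (x - y)\<bar> \<le> norm p * norm (x - y)" by (rule Cauchy_Schwarz_ineq2)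
  also have "\<dots> \<le> L * norm (x - y)" using assms by (rule mult_right_mono) simp
  finally show "dist (p \<bullet> x + c) (p \<bullet> y + c) \<le> L * dist x y"
    by (simp add: dist_norm inner_diff_right)
qed

context
  fixes l :: real and b :: "real^'n"
  assumes l: "0 < l" "l < 1"
begin

lemma tooth_nonneg: "0 \<le> tooth l t"
  using l mult_nonneg_nonneg[of "1 - l" t] mult_nonneg_nonneg[of l "- t"]
  unfolding tooth_def le_max_iff_disj by (cases "0 \<le> t") auto

lemma tooth_le: "0 \<le> t \<Longrightarrow> t \<le> s \<Longrightarrow> tooth l t \<le> (1 - l) * s"
proof -
  assume t: "0 \<le> t" "t \<le> s"
  have "(1 - l) * t \<le> (1 - l) * s" "0 \<le> l * t" "0 \<le> (1 - l) * s"
    using l t by (auto intro: mult_left_mono)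
  then show ?thesis by (simp add: tooth_def)
qed

lemma tooth_ge: "min l (1 - l) * \<bar>t\<bar> \<le> tooth l t"
proof (cases "t \<ge> 0")
  case True
  then have "min l (1 - l) * t \<le> (1 - l) * t" by (intro mult_right_mono) auto
  with True show ?thesis by (simp add: tooth_def le_max_iff_disj)
next
  case False
  then have "min l (1 - l) * (- t) \<le> l * (- t)" by (intro mult_right_mono) auto
  with False show ?thesis by (simp add: tooth_def le_max_iff_disj)
qed

text \<open>The lattice point to the left of \<open>t\<close> puts \<open>t\<close> on the rising
  branch, within \<open>s\<close> of the bottom. The gain of \<open>l * s\<close> against
  \<open>s\<close> is what the branching construction lives on.\<close>

lemma tooth_lattice_le:
  assumes "s > 0"
  shows "tooth l (t - of_int \<lfloor>t / s\<rfloor> * s) \<le> (1 - l) * s"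
proof (rule tooth_le)
  have "of_int \<lfloor>t / s\<rfloor> * s \<le> t" "t < (of_int \<lfloor>t / s\<rfloor> + 1) * s"
    unfolding pos_le_divide_eq[OF assms, symmetric] pos_divide_less_eq[OF assms, symmetric] by linarith+
  then show "0 \<le> t - of_int \<lfloor>t / s\<rfloor> * s" "t - of_int \<lfloor>t / s\<rfloor> * s \<le> s"
    by (simp_all add: algebra_simps)
qed

text \<open>By the linear growth of \<open>tooth\<close>, lattice points far from \<open>t\<close>
  lose. The bound on \<open>m\<close> is uniform over all spacings from \<open>s0\<close> on, since
  several spacings compete at once in the branched laminate.\<close>

lemma tooth_lattice_far:
  assumes s: "0 < s0" "s0 \<le> s" and t: "\<bar>t\<bar> \<le> B" and v: "0 \<le> v"
    and m: "(B + v / min l (1 - l)) / s0 < \<bar>of_int m\<bar>"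
  shows "v \<le> tooth l (t - of_int m * s)"
proof -
  let ?\<mu> = "min l (1 - l)"
  have \<mu>: "?\<mu> > 0" using l by simp
  have "B + v / ?\<mu> < \<bar>of_int m\<bar> * s0" using m s by (simp add: field_simps)
  also have "\<dots> \<le> \<bar>of_int m\<bar> * s" using s by (intro mult_left_mono) auto
  also have "\<dots> = \<bar>of_int m * s\<bar>" using s by (simp add: abs_mult)
  finally have "v / ?\<mu> \<le> \<bar>t - of_int m * s\<bar>" using t by linarith
  then have "v \<le> ?\<mu> * \<bar>t - of_int m * s\<bar>" using \<mu> by (simp add: field_simps)
  also have "\<dots> \<le> tooth l (t - of_int m * s)" by (rule tooth_ge)
  finally show ?thesis .
qed

lemma lipschitz_on_tooth: "(norm b)-lipschitz_on UNIV (\<lambda>x. tooth l (b \<bullet> x - c))"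
proof -
  have "(norm b)-lipschitz_on UNIV (\<lambda>x. max ((((1 - l) *\<^sub>R b) \<bullet> x + (- (1 - l) * c))) (((- l) *\<^sub>R b) \<bullet> x + l * c))"
    using l by (intro lipschitz_on_max lipschitz_on_affine) (auto intro!: mult_left_le_one_le)
  then show ?thesis by (simp add: tooth_def algebra_simps)
qed

lemma tooth_pieces:
  "\<exists>(p, d)\<in>{((1 - l) *\<^sub>R b, - (1 - l) * c), ((- l) *\<^sub>R b, l * c)}. tooth l (b \<bullet> x - c) = p \<bullet> x + d"
  by (auto simp: tooth_def max_def algebra_simps)

text \<open>The sawtooth of period \<open>s\<close> in direction \<open>b\<close>, its teeth
  standing on the multiples of \<open>s\<close>. Refining it lowers the height and keeps the
  slopes.\<close>

definition laminate :: "real \<Rightarrow> real^'n \<Rightarrow> real" where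
  "laminate s x = (INF m\<in>(UNIV :: int set). tooth l (b \<bullet> x - of_int m * s))"

lemma laminate_bounds:
  assumes "s > 0" shows "0 \<le> laminate s x" "laminate s x \<le> s"
proof -
  show "0 \<le> laminate s x" unfolding laminate_def by (rule cINF_greatest) (auto simp: tooth_nonneg)
  have "laminate s x \<le> tooth l (b \<bullet> x - of_int \<lfloor>(b \<bullet> x) / s\<rfloor> * s)"
    unfolding laminate_def by (rule cINF_lower) (auto intro!: bdd_belowI[of _ 0] simp: tooth_nonneg)
  also have "\<dots> \<le> (1 - l) * s" by (rule tooth_lattice_le[OF assms])
  also have "\<dots> \<le> s" using l assms by (intro mult_left_le_one_le) auto
  finally show "laminate s x \<le> s" .
qed

lemma lipschitz_on_laminate: "(norm b)-lipschitz_on UNIV (laminate s)"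
  unfolding laminate_def
  by (rule lipschitz_on_INF) (auto simp: tooth_nonneg lipschitz_on_tooth)

lemma ess_sup_Q_laminate:
  fixes a :: "real^'m" and h :: "real^'n^'m \<Rightarrow> real"
  assumes s: "s > 0" and h: "h (outer_product a ((1 - l) *\<^sub>R b)) \<le> C" "h (outer_product a ((- l) *\<^sub>R b)) \<le> C"
  shows "ess_sup_Q (\<lambda>x. h (grad (\<lambda>x. laminate s x *\<^sub>R a) x)) \<le> ereal C"
  unfolding laminate_def
proof (rule ess_sup_Q_INF_piecewise_affine[where L = "norm b"
      and P = "\<lambda>m. {((1 - l) *\<^sub>R b, - (1 - l) * (of_int m * s)), ((- l) *\<^sub>R b, l * (of_int m * s))}"])
  fix x :: "real^'n"
  define B where "B = norm b * (norm x + 1)"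
  have B: "\<bar>b \<bullet> y\<bar> \<le> B" if "y \<in> ball x 1" for y
  proof -
    have "norm y \<le> norm x + 1" using that norm_triangle_ineq2[of y x] by (simp add: dist_norm norm_minus_commute)
    then have "norm b * norm y \<le> B" unfolding B_def by (rule mult_left_mono) simp
    then show ?thesis using Cauchy_Schwarz_ineq2[of b y] by linarith
  qed
  \<comment> \<open>The first summand makes teeth with index beyond \<open>M\<close> at least
    \<open>s\<close> high on the ball; the second keeps the index of the lattice point on the left
    in range, with \<open>+ 1\<close> absorbing the rounding of the floor.\<close>
  define M where "M = \<lceil>(B + s / min l (1 - l)) / s + B / s + 1\<rceil>"
  have M: "(B + s / min l (1 - l)) / s \<le> of_int M" "B / s + 1 \<le> of_int M"
  proof -
    have "0 \<le> B" by (simp add: B_def)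
    then have "0 \<le> B / s" "0 \<le> (B + s / min l (1 - l)) / s" using s l by auto
    then show "(B + s / min l (1 - l)) / s \<le> of_int M" "B / s + 1 \<le> of_int M"
      unfolding M_def by linarith+
  qed
  have "\<exists>i0\<in>{-M..M}. \<forall>i\<in>UNIV - {-M..M}. tooth l (b \<bullet> y - of_int i0 * s) \<le> tooth l (b \<bullet> y - of_int i * s)"
    if y: "y \<in> ball x 1" for y
  proof (intro bexI ballI)
    have "\<bar>b \<bullet> y / s\<bar> \<le> B / s" using B[OF y] s by (simp add: divide_right_mono)
    then have "- M \<le> \<lfloor>b \<bullet> y / s\<rfloor>" "\<lfloor>b \<bullet> y / s\<rfloor> \<le> M" using M(2) by linarith+
    then show "\<lfloor>b \<bullet> y / s\<rfloor> \<in> {-M..M}" by simp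
    fix i assume "i \<in> UNIV - {-M..M}"
    then have "of_int M < \<bar>of_int i :: real\<bar>" by auto
    then have "(B + s / min l (1 - l)) / s < \<bar>of_int i\<bar>" using M(1) by linarith
    then have "s \<le> tooth l (b \<bullet> y - of_int i * s)"
      using tooth_lattice_far[OF s order_refl B[OF y]] s by simp
    moreover have "(1 - l) * s \<le> s" using l s by (intro mult_left_le_one_le) auto
    ultimately show "tooth l (b \<bullet> y - of_int \<lfloor>b \<bullet> y / s\<rfloor> * s) \<le> tooth l (b \<bullet> y - of_int i * s)"
      using tooth_lattice_le[OF s, of "b \<bullet> y"] by linarith
  qed
  then show "\<exists>e>0. \<exists>I0\<subseteq>UNIV. finite I0 \<and> (\<forall>y\<in>ball x e. \<exists>i0\<in>I0. \<forall>i\<in>UNIV - I0.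
      tooth l (b \<bullet> y - of_int i0 * s) \<le> tooth l (b \<bullet> y - of_int i * s))"
    by (intro exI[of _ 1] conjI exI[of _ "{-M..M}"]) auto
next
  show "\<exists>(p, c)\<in>{((1 - l) *\<^sub>R b, - (1 - l) * (of_int m * s)), ((- l) *\<^sub>R b, l * (of_int m * s))}.
    tooth l (b \<bullet> x - of_int m * s) = p \<bullet> x + c" for m x
    by (rule tooth_pieces)
qed (use h in \<open>auto simp: tooth_nonneg lipschitz_on_tooth\<close>)

text \<open>Laminates of period \<open>1 / (j + 1)\<close>, made more expensive away from the boundary the finer they are. Hence at
  positive distance \<open>y\<close> from the boundary only finitely many terms compete for the infimum: a term with \<open>1 / (j + 1) \<le> r y\<close> attains
  at most \<open>r y - l / (j + 1)\<close>, whereas the terms with \<open>j\<close> large are close to \<open>r y\<close>. At and beyond a face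
  (\<open>\<bar>x $ i\<bar> \<ge> 1/2\<close>) the penalty vanishes and the infimum is \<open>0\<close>. The minimum over the
  coordinates \<open>i\<close>, which gives the distance to the boundary, is part of the same infimum.\<close>

definition branching_term :: "real \<Rightarrow> nat \<times> int \<times> 'n \<Rightarrow> real^'n \<Rightarrow> real" where
  "branching_term r = (\<lambda>(j, m, i) x. tooth l (b \<bullet> x - of_int m * inverse (Suc j))
     + max 0 (r * (1/2 - \<bar>x $ i\<bar>) - inverse (Suc j)))"

definition branching :: "real \<Rightarrow> real^'n \<Rightarrow> real" where
  "branching r x = (INF k\<in>UNIV. branching_term r k x)"

lemma branching_term_nonneg: "0 \<le> branching_term r k x"
  by (cases k) (simp add: branching_term_def tooth_nonneg add_nonneg_nonneg)

text \<open>Two pieces of the tooth combine with three of the penalty: zero, and one for each sign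
  of \<open>x $ i\<close>. Every slope is thus a laminate slope plus \<open>0\<close>,
  \<open>axis i r\<close> or \<open>axis i (- r)\<close>.\<close>

lemma branching_term_pieces:
  "\<exists>(p, d)\<in>(\<lambda>((p, c), (q, d)). (p + q, c + d)) `
     ({((1 - l) *\<^sub>R b, - (1 - l) * (of_int m * inverse (Suc j))), ((- l) *\<^sub>R b, l * (of_int m * inverse (Suc j)))} \<times>
      {(0, 0), (axis i (- r), r / 2 - inverse (Suc j)), (axis i r, r / 2 - inverse (Suc j))}).
    branching_term r (j, m, i) x = p \<bullet> x + d"
proof -
  obtain p d where pd: "(p, d) \<in> {((1 - l) *\<^sub>R b, - (1 - l) * (of_int m * inverse (Suc j))), ((- l) *\<^sub>R b, l * (of_int m * inverse (Suc j)))}"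
    "tooth l (b \<bullet> x - of_int m * inverse (Suc j)) = p \<bullet> x + d"
    using tooth_pieces[of "of_int m * inverse (Suc j)" x] by blast
  obtain q e where qe: "(q, e) \<in> {(0, 0), (axis i (- r), r / 2 - inverse (Suc j)), (axis i r, r / 2 - inverse (Suc j))}"
    "max 0 (r * (1/2 - \<bar>x $ i\<bar>) - inverse (Suc j)) = q \<bullet> x + e"
  proof -
    consider "max 0 (r * (1/2 - \<bar>x $ i\<bar>) - inverse (Suc j)) = 0"
      | "max 0 (r * (1/2 - \<bar>x $ i\<bar>) - inverse (Suc j)) = axis i (- r) \<bullet> x + (r / 2 - inverse (Suc j))"
      | "max 0 (r * (1/2 - \<bar>x $ i\<bar>) - inverse (Suc j)) = axis i r \<bullet> x + (r / 2 - inverse (Suc j))"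
    proof (cases "x $ i \<ge> 0")
      case True
      then have "r * (1/2 - \<bar>x $ i\<bar>) - inverse (Suc j) = axis i (- r) \<bullet> x + (r / 2 - inverse (Suc j))"
        by (simp add: inner_axis' algebra_simps)
      then show thesis using that(1,2) by (metis max_def)
    next
      case False
      then have "r * (1/2 - \<bar>x $ i\<bar>) - inverse (Suc j) = axis i r \<bullet> x + (r / 2 - inverse (Suc j))"
        by (simp add: inner_axis' algebra_simps)
      then show thesis using that(1,3) by (metis max_def)
    qed
    then show thesis
    proof cases
      case 1 then show thesis by (intro that[of 0 0]) auto
    next
      case 2 then show thesis by (intro that[of "axis i (- r)" "r / 2 - inverse (Suc j)"]) auto
    next
      case 3 then show thesis by (intro that[of "axis i r" "r / 2 - inverse (Suc j)"]) auto
    qed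
  qed
  show ?thesis
  proof (rule bexI[of _ "(p + q, d + e)"])
    show "case (p + q, d + e) of (p, d) \<Rightarrow> branching_term r (j, m, i) x = p \<bullet> x + d"
      unfolding branching_term_def using pd(2) qe(2) by (simp add: inner_add_left)
    show "(p + q, d + e) \<in> (\<lambda>((p, c), (q, d)). (p + q, c + d)) `
     ({((1 - l) *\<^sub>R b, - (1 - l) * (of_int m * inverse (Suc j))), ((- l) *\<^sub>R b, l * (of_int m * inverse (Suc j)))} \<times>
      {(0, 0), (axis i (- r), r / 2 - inverse (Suc j)), (axis i r, r / 2 - inverse (Suc j))})"
      using pd(1) qe(1) by (intro image_eqI[of _ _ "((p, d), (q, e))"]) auto
  qed
qed

lemma lipschitz_on_branching_term:
  assumes "0 \<le> r" shows "(norm b + r)-lipschitz_on UNIV (branching_term r k)"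
proof -
  obtain j m i where k: "k = (j, m, i)" by (cases k)
  have "r-lipschitz_on UNIV (\<lambda>x. max 0 (r * (1/2 - \<bar>x $ i\<bar>) - inverse (Suc j)))"
  proof (rule lipschitz_on_max)
    show "r-lipschitz_on UNIV (\<lambda>x::real^'n. 0)" using assms by (intro lipschitz_onI) auto
    show "r-lipschitz_on UNIV (\<lambda>x. r * (1/2 - \<bar>x $ i\<bar>) - inverse (Suc j))"
    proof (rule lipschitz_onI)
      fix x y :: "real^'n"
      have "\<bar>\<bar>y $ i\<bar> - \<bar>x $ i\<bar>\<bar> \<le> norm (x - y)"
        using component_le_norm_cart[of "x - y" i] by simp
      then have "r * \<bar>\<bar>y $ i\<bar> - \<bar>x $ i\<bar>\<bar> \<le> r * norm (x - y)" using assms by (rule mult_left_mono)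
      moreover have "\<bar>r * (1/2 - \<bar>x $ i\<bar>) - inverse (Suc j) - (r * (1/2 - \<bar>y $ i\<bar>) - inverse (Suc j))\<bar> = r * \<bar>\<bar>y $ i\<bar> - \<bar>x $ i\<bar>\<bar>"
      proof -
        have "r * (1/2 - \<bar>x $ i\<bar>) - inverse (Suc j) - (r * (1/2 - \<bar>y $ i\<bar>) - inverse (Suc j)) = r * (\<bar>y $ i\<bar> - \<bar>x $ i\<bar>)"
          by (simp add: algebra_simps)
        then show ?thesis using assms by (simp add: abs_mult)
      qed
      ultimately show "dist (r * (1/2 - \<bar>x $ i\<bar>) - inverse (Suc j)) (r * (1/2 - \<bar>y $ i\<bar>) - inverse (Suc j)) \<le> r * dist x y"
        by (simp add: dist_real_def dist_norm)
    qed (rule assms)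
  qed
  from lipschitz_on_add[OF lipschitz_on_tooth this] show ?thesis by (simp add: k branching_term_def)
qed

lemma branching_nonneg: "0 \<le> branching r x"
  unfolding branching_def by (rule cINF_greatest) (auto simp: branching_term_nonneg)

lemma branching_le_term: "branching r x \<le> branching_term r k x"
  unfolding branching_def by (rule cINF_lower) (auto intro!: bdd_belowI[of _ 0] simp: branching_term_nonneg)

lemma lipschitz_on_branching: "0 \<le> r \<Longrightarrow> (norm b + r)-lipschitz_on UNIV (branching r)"
  unfolding branching_def by (rule lipschitz_on_INF) (auto simp: branching_term_nonneg lipschitz_on_branching_term)

lemma branching_outside:
  assumes "0 \<le> r" "x \<notin> unit_cube" shows "branching r x = 0"
proof -
  obtain i where i: "1/2 \<le> \<bar>x $ i\<bar>" using assms(2) by (auto simp: mem_unit_cube not_less)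
  have "branching r x \<le> inverse (Suc j)" for j
  proof -
    have s: "inverse (real (Suc j)) > 0" by simp
    have "r * (1/2 - \<bar>x $ i\<bar>) \<le> 0" using i assms(1) by (simp add: mult_nonneg_nonpos)
    then have "max 0 (r * (1/2 - \<bar>x $ i\<bar>) - inverse (real (Suc j))) = 0"
      using s by (intro max_absorb1) linarith
    then have "branching_term r (j, \<lfloor>b \<bullet> x / inverse (real (Suc j))\<rfloor>, i) x \<le> (1 - l) * inverse (real (Suc j))"
      unfolding branching_term_def prod.case using tooth_lattice_le[OF s, of "b \<bullet> x"] by linarith
    also have "\<dots> \<le> inverse (Suc j)" using l s by (intro mult_left_le_one_le) auto
    finally show ?thesis using branching_le_term order_trans by blast
  qed
  then have "branching r x \<le> 0"
    by (intro LIMSEQ_le_const[OF LIMSEQ_inverse_real_of_nat]) auto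
  with branching_nonneg[of r x] show ?thesis by simp
qed

text \<open>The point to prove is local finiteness inside the cube. With \<open>i\<close> the
  coordinate of the nearest face, a competitor of spacing \<open>s1\<close> has value at most
  \<open>r * w y i - l * s1\<close>; much finer terms exceed this by their penalty, remote teeth by
  their height.\<close>

lemma ess_sup_Q_branching:
  fixes a :: "real^'m" and h :: "real^'n^'m \<Rightarrow> real"
  assumes r: "r > 0"
    and h: "\<And>p q. p \<in> {(1 - l) *\<^sub>R b, (- l) *\<^sub>R b} \<Longrightarrow> q = 0 \<or> (\<exists>i. q = axis i r \<or> q = axis i (- r)) \<Longrightarrow>
      h (outer_product a (p + q)) \<le> C"
  shows "ess_sup_Q (\<lambda>x. h (grad (\<lambda>x. branching r x *\<^sub>R a) x)) \<le> ereal C"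
  unfolding branching_def
proof (rule ess_sup_Q_INF_piecewise_affine[where L = "norm b + r"
      and P = "\<lambda>(j, m, i). (\<lambda>((p, c), (q, d)). (p + q, c + d)) `
     ({((1 - l) *\<^sub>R b, - (1 - l) * (of_int m * inverse (Suc j))), ((- l) *\<^sub>R b, l * (of_int m * inverse (Suc j)))} \<times>
      {(0, 0), (axis i (- r), r / 2 - inverse (Suc j)), (axis i r, r / 2 - inverse (Suc j))})"])
  fix x :: "real^'n" assume x: "x \<in> unit_cube"
  define w where "w y i = 1/2 - \<bar>y $ i\<bar>" for y :: "real^'n" and i
  \<comment> \<open>Half the distance from \<open>x\<close> to the boundary: throughout the ball of
    this radius all faces stay at distance at least \<open>d\<close>.\<close>
  define d where "d = Min (range (w x)) / 2"
  have dw: "2 * d \<le> w x i" for i by (simp add: d_def)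
  have "Min (range (w x)) \<in> range (w x)" by (rule Min_in) auto
  then obtain i0 where "Min (range (w x)) = w x i0" by (rule imageE)
  moreover have "0 < w x i0" "w x i0 \<le> 1/2" using x by (auto simp: w_def mem_unit_cube)
  ultimately have d: "0 < d" "d < 1" by (simp_all add: d_def)
  have wy: "d \<le> w y i" if "y \<in> ball x d" for y i
  proof -
    have "\<bar>(x - y) $ i\<bar> < d" using that component_le_norm_cart[of "x - y" i] by (simp add: dist_norm)
    then show ?thesis using dw[of i] unfolding w_def by simp
  qed
  define B where "B = norm b * (norm x + 1)"
  have B0: "0 \<le> B" by (simp add: B_def)
  have B: "\<bar>b \<bullet> y\<bar> \<le> B" if "y \<in> ball x d" for y
  proof -
    have "norm y \<le> norm x + 1" using that d norm_triangle_ineq2[of y x] by (simp add: dist_norm norm_minus_commute)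
    then have "norm b * norm y \<le> B" unfolding B_def by (rule mult_left_mono) simp
    then show ?thesis using Cauchy_Schwarz_ineq2[of b y] by linarith
  qed
  \<comment> \<open>With \<open>s1 \<le> r * d\<close> the penalty of the competitor is nowhere cut
    off at 0 on the ball, so the full \<open>s1\<close> is deducted.\<close>
  obtain j1 where "inverse (real (Suc j1)) < r * d" using reals_Archimedean[of "r * d"] r d by auto
  define s1 where "s1 = inverse (real (Suc j1))"
  have s1: "0 < s1" "s1 \<le> r * d" using \<open>_ < r * d\<close> by (simp_all add: s1_def)
  \<comment> \<open>Terms of spacing at most \<open>s2\<close> pay at least
    \<open>r * w y i - s2\<close>, which exceeds the value of the competitor once
    \<open>s2 < l * s1\<close>.\<close>
  obtain j2 where "inverse (real (Suc j2)) < l * s1" using reals_Archimedean[of "l * s1"] s1 l by auto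
  define s2 where "s2 = inverse (real (Suc j2))"
  have s2: "0 < s2" "s2 < l * s1" using \<open>_ < l * s1\<close> by (simp_all add: s2_def)
  have "l * s1 < s1" using l s1 by simp
  then have "s2 < s1" using s2 by linarith
  then have j12: "j1 < j2" by (simp add: s1_def s2_def)
  \<comment> \<open>For all spacings from \<open>s2\<close> on, teeth beyond \<open>M\<close> reach
    \<open>r / 2\<close>, which bounds \<open>r * w y i\<close> because \<open>w\<close> is at most
    1/2. The second summand keeps the competitor itself in range.\<close>
  define M where "M = \<lceil>(B + r / 2 / min l (1 - l)) / s2 + B / s1 + 1\<rceil>"
  have M: "(B + r / 2 / min l (1 - l)) / s2 \<le> of_int M" "B / s1 + 1 \<le> of_int M"
  proof -
    have "0 \<le> B / s1" "0 \<le> (B + r / 2 / min l (1 - l)) / s2" using B0 s1 s2 l r by auto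
    then show "(B + r / 2 / min l (1 - l)) / s2 \<le> of_int M" "B / s1 + 1 \<le> of_int M"
      unfolding M_def by linarith+
  qed
  let ?I = "{..<j2} \<times> {-M..M} \<times> (UNIV :: 'n set)"
  have "\<exists>k0\<in>?I. \<forall>k\<in>UNIV - ?I. branching_term r k0 y \<le> branching_term r k y" if y: "y \<in> ball x d" for y
  proof -
    obtain i where i: "\<And>i'. w y i \<le> w y i'"
    proof -
      have "Min (range (w y)) \<in> range (w y)" by (rule Min_in) auto
      then obtain i where "Min (range (w y)) = w y i" by (rule imageE)
      then show thesis using that[of i] by (metis Min_le finite finite_imageI rangeI)
    qed
    have "r * d \<le> r * w y i" using wy[OF y] r by (intro mult_left_mono) auto
    then have "max 0 (r * w y i - s1) = r * w y i - s1" using s1(2) by (intro max_absorb2) linarith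
    then have c0: "branching_term r (j1, \<lfloor>b \<bullet> y / s1\<rfloor>, i) y \<le> r * w y i - l * s1"
      unfolding branching_term_def prod.case s1_def[symmetric] w_def[symmetric]
      using tooth_lattice_le[OF s1(1), of "b \<bullet> y"] left_diff_distrib[of 1 l s1] by linarith
    have in0: "(j1, \<lfloor>b \<bullet> y / s1\<rfloor>, i) \<in> ?I"
    proof -
      have "\<bar>b \<bullet> y / s1\<bar> \<le> B / s1" using B[OF y] s1 by (simp add: divide_right_mono)
      then have "- M \<le> \<lfloor>b \<bullet> y / s1\<rfloor>" "\<lfloor>b \<bullet> y / s1\<rfloor> \<le> M" using M(2) by linarith+
      then show ?thesis using j12 by simp
    qed
    have far: "r * w y i - l * s1 \<le> branching_term r (j, m, i') y" if k: "(j, m, i') \<notin> ?I" for j m i'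
    proof (cases "j2 \<le> j")
      case True
      have "inverse (real (Suc j)) \<le> s2" unfolding s2_def using True by (intro le_imp_inverse_le) auto
      moreover have "r * w y i \<le> r * w y i'" using i r by (intro mult_left_mono) auto
      moreover have "r * w y i' - inverse (real (Suc j)) \<le> branching_term r (j, m, i') y"
        using tooth_nonneg unfolding branching_term_def w_def by (simp add: add_increasing)
      ultimately show ?thesis using s2 by linarith
    next
      case False
      with k have "of_int M < \<bar>of_int m :: real\<bar>" by auto
      then have "(B + r / 2 / min l (1 - l)) / s2 < \<bar>of_int m\<bar>" using M(1) by linarith
      moreover have "s2 \<le> inverse (real (Suc j))" unfolding s2_def using False by (intro le_imp_inverse_le) auto
      ultimately have "r / 2 \<le> tooth l (b \<bullet> y - of_int m * inverse (real (Suc j)))"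
        using r by (intro tooth_lattice_far[OF s2(1) _ B[OF y]]) auto
      also have "\<dots> \<le> branching_term r (j, m, i') y" by (simp add: branching_term_def)
      finally have "r / 2 \<le> branching_term r (j, m, i') y" .
      moreover have "r * w y i \<le> r * (1/2)" using r by (intro mult_left_mono) (auto simp: w_def)
      moreover have "0 < l * s1" using l s1 by simp
      ultimately show ?thesis by linarith
    qed
    have "\<forall>k\<in>UNIV - ?I. branching_term r (j1, \<lfloor>b \<bullet> y / s1\<rfloor>, i) y \<le> branching_term r k y"
    proof
      fix k assume "k \<in> UNIV - ?I"
      then show "branching_term r (j1, \<lfloor>b \<bullet> y / s1\<rfloor>, i) y \<le> branching_term r k y"
        using order_trans[OF c0 far] by (cases k) blast
    qed
    with in0 show ?thesis by blast
  qed
  then show "\<exists>e>0. \<exists>I0\<subseteq>UNIV. finite I0 \<and> (\<forall>y\<in>ball x e. \<exists>i0\<in>I0. \<forall>i\<in>UNIV - I0. branching_term r i0 y \<le> branching_term r i y)"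
    using d(1) by (intro exI[of _ d] conjI exI[of _ ?I]) auto
next
  fix k :: "nat \<times> int \<times> 'n" and x
  obtain j m i where k: "k = (j, m, i)" by (cases k)
  show "\<exists>(p, c)\<in>(case k of (j, m, i) \<Rightarrow> (\<lambda>((p, c), (q, d)). (p + q, c + d)) `
     ({((1 - l) *\<^sub>R b, - (1 - l) * (of_int m * inverse (Suc j))), ((- l) *\<^sub>R b, l * (of_int m * inverse (Suc j)))} \<times>
      {(0, 0), (axis i (- r), r / 2 - inverse (Suc j)), (axis i r, r / 2 - inverse (Suc j))})). branching_term r k x = p \<bullet> x + c"
    unfolding k prod.case by (rule branching_term_pieces)
next
  fix k :: "nat \<times> int \<times> 'n" and p c
  assume pc: "(p, c) \<in> (case k of (j, m, i) \<Rightarrow> (\<lambda>((p, c), (q, d)). (p + q, c + d)) `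
     ({((1 - l) *\<^sub>R b, - (1 - l) * (of_int m * inverse (Suc j))), ((- l) *\<^sub>R b, l * (of_int m * inverse (Suc j)))} \<times>
      {(0, 0), (axis i (- r), r / 2 - inverse (Suc j)), (axis i r, r / 2 - inverse (Suc j))}))"
  obtain j m i where k: "k = (j, m, i)" by (cases k)
  from pc obtain p' q where "p = p' + q" "p' \<in> {(1 - l) *\<^sub>R b, (- l) *\<^sub>R b}" "q = 0 \<or> q = axis i r \<or> q = axis i (- r)"
    unfolding k prod.case by force
  then show "h (outer_product a p) \<le> C" using h by blast
qed (use r in \<open>auto simp: branching_term_nonneg lipschitz_on_branching_term\<close>)

end

section \<open>Minors and rank-one directions\<close>

lemma rank_eq_1_if_thin:
  fixes A :: "real^'n^'m"
  assumes "CARD('n) = 1 \<or> CARD('m) = 1" "A \<noteq> 0"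
  shows "rank A = 1"
proof -
  have "rank A \<noteq> 0" using assms(2) rank_eq_0 by blast
  moreover have "rank A \<le> 1" using rank_bound[of A] assms(1) by auto
  ultimately show ?thesis by linarith
qed

text \<open>With a single row or column every nonzero matrix has rank one, so the two conditions
  differ only for equal matrices, where the inequality is trivial.\<close>

lemma level_convex_iff_rank_one:
  fixes f :: "real^'n^'m \<Rightarrow> real"
  assumes "CARD('n) = 1 \<or> CARD('m) = 1"
  shows "level_convex f \<longleftrightarrow> rank_one_quasiconvex f"
proof
  assume r: "rank_one_quasiconvex f"
  show "level_convex f" unfolding level_convex_on_def
  proof (intro ballI allI impI)
    fix x y :: "real^'n^'m" and l :: real assume l: "0 < l \<and> l < 1"
    show "f (l *\<^sub>R x + (1 - l) *\<^sub>R y) \<le> max (f x) (f y)"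
    proof (cases "x = y")
      case True
      then show ?thesis by (simp flip: scaleR_left_distrib)
    next
      case False
      then have "rank (x - y) = 1" by (intro rank_eq_1_if_thin[OF assms]) simp
      with r l show ?thesis unfolding rank_one_quasiconvex_def by blast
    qed
  qed
qed (auto simp: level_convex_on_def rank_one_quasiconvex_def)

section \<open>Minors and polyquasiconvexity\<close>

lemma bij_betw_enum_idx: "bij_betw (enum_idx :: nat \<Rightarrow> 'a::finite) {..<CARD('a)} UNIV"
proof -
  have "\<exists>e. bij_betw e {..<CARD('a)} (UNIV :: 'a set)"
    using ex_bij_betw_nat_finite[of "UNIV :: 'a set"] by (simp add: atLeast0LessThan)
  then show ?thesis unfolding enum_idx_def by (rule someI_ex)
qed

definition idx :: "'a::finite \<Rightarrow> nat" where
  "idx = the_inv_into {..<CARD('a)} enum_idx"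

lemma idx_less: "idx (x :: 'a::finite) < CARD('a)"
  and enum_idx_idx: "enum_idx (idx x) = x"
proof -
  have *: "inj_on (enum_idx :: nat \<Rightarrow> 'a) {..<CARD('a)}" "x \<in> enum_idx ` {..<CARD('a)}"
    using bij_betw_enum_idx[where 'a='a] by (auto simp: bij_betw_def)
  then show "idx x < CARD('a)" "enum_idx (idx x) = x"
    unfolding idx_def using the_inv_into_into[OF * order_refl] f_the_inv_into_f[OF *] by auto
qed

lemma minor_singleton: "minor \<xi> {p} {q} = \<xi> $ enum_idx p $ enum_idx q"
proof -
  have "{..<Suc 0} = {0}" by auto
  then have "det_nat (Suc 0) A = A 0 0" for A by (simp add: det_nat_def permutes_sing sign_id)
  then show ?thesis by (simp add: minor_def)
qed

lemma minors_vec_entry: "minors_vec (\<xi> :: real^'n^'m) ({idx k}, {idx i}) = \<xi> $ k $ i"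
  by (simp add: minors_vec_def minor_idx_def idx_less minor_singleton enum_idx_idx)

lemma minors_vec_in_minor_space:
  "minors_vec (\<xi> :: real^'n^'m) \<in> minor_space TYPE('n) TYPE('m)"
  by (auto simp: minor_space_def minors_vec_def)

text \<open>\<open>R\<close> reads a matrix linearly off its 1-by-1 minors, and level convexity
  survives composition with a linear map, so \<open>f \<circ> R\<close> serves as \<open>g\<close>
  in any dimension.\<close>

lemma level_convex_imp_polyquasiconvex:
  fixes f :: "real^'n^'m \<Rightarrow> real"
  assumes lc: "level_convex f" shows "polyquasiconvex f"
proof -
  define R :: "(nat set \<times> nat set \<Rightarrow> real) \<Rightarrow> real^'n^'m" where "R v = (\<chi> k i. v ({idx k}, {idx i}))" for v
  have "R (\<lambda>k. l * v k + (1 - l) * w k) = l *\<^sub>R R v + (1 - l) *\<^sub>R R w" for l v w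
    by (simp add: R_def vec_eq_iff)
  then have "0 < l \<and> l < 1 \<longrightarrow> f (R (\<lambda>k. l * v k + (1 - l) * w k)) \<le> max (f (R v)) (f (R w))" for l v w
    using lc by (simp add: level_convex_on_def)
  moreover have "R (minors_vec \<xi>) = \<xi>" for \<xi> by (simp add: R_def vec_eq_iff minors_vec_entry)
  ultimately show ?thesis unfolding polyquasiconvex_def by (intro exI[of _ "f \<circ> R"]) simp
qed

text \<open>With a single row or column the only minors are the entries, so
  \<open>minors_vec\<close> is linear and level convexity of \<open>g\<close> pulls back.\<close>

lemma polyquasiconvex_imp_level_convex:
  fixes f :: "real^'n^'m \<Rightarrow> real"
  assumes dim: "CARD('n) = 1 \<or> CARD('m) = 1" and pq: "polyquasiconvex f"
  shows "level_convex f"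
proof -
  have lin: "minors_vec (l *\<^sub>R \<xi> + (1 - l) *\<^sub>R \<eta>) = (\<lambda>k. l * minors_vec \<xi> k + (1 - l) * minors_vec \<eta> k)"
    for l and \<xi> \<eta> :: "real^'n^'m"
  proof (rule ext, safe)
    fix I J
    show "minors_vec (l *\<^sub>R \<xi> + (1 - l) *\<^sub>R \<eta>) (I, J) = l * minors_vec \<xi> (I, J) + (1 - l) * minors_vec \<eta> (I, J)"
    proof (cases "(I, J) \<in> minor_idx TYPE('n) TYPE('m)")
      case True
      then have IJ: "I \<subseteq> {..<CARD('m)}" "J \<subseteq> {..<CARD('n)}" "card I = card J" "1 \<le> card I"
        by (auto simp: minor_idx_def)
      have "card I \<le> CARD('m)" "card J \<le> CARD('n)"
        using card_mono[OF _ IJ(1)] card_mono[OF _ IJ(2)] by auto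
      with IJ dim have "card I = 1" "card J = 1" by auto
      then obtain p q where "I = {p}" "J = {q}" by (auto simp: card_1_singleton_iff)
      then show ?thesis by (simp add: minors_vec_def minor_singleton)
    qed (simp add: minors_vec_def)
  qed
  from pq obtain g where g1: "\<forall>v\<in>minor_space TYPE('n) TYPE('m). \<forall>w\<in>minor_space TYPE('n) TYPE('m). \<forall>l::real.
      0 < l \<and> l < 1 \<longrightarrow> g (\<lambda>k. l * v k + (1 - l) * w k) \<le> max (g v) (g w)"
    and g2: "\<forall>\<xi>. f \<xi> = g (minors_vec \<xi>)"
    unfolding polyquasiconvex_def by (elim exE conjE)
  show ?thesis unfolding level_convex_on_def g2[rule_format] lin
    by (intro ballI allI g1[THEN bspec, THEN bspec, THEN spec] minors_vec_in_minor_space)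
qed

section \<open>Equivalence of the notions\<close>

lemma outer_product_column:
  fixes M :: "real^'n^'m"
  assumes k: "(UNIV :: 'n set) = {k}"
  shows "outer_product (column k M) (axis k 1) = M"
proof -
  have "column k M $ i * (axis k 1 :: real^'n) $ j = M $ i $ j" for i j
    using UNIV_I[of j, unfolded k] by (simp add: column_def axis_def)
  then show ?thesis unfolding outer_product_def vec_eq_iff vec_lambda_beta by blast
qed

lemma outer_product_row:
  fixes M :: "real^'n^'m"
  assumes k: "(UNIV :: 'm set) = {k}"
  shows "outer_product (axis k 1) (M $ k) = M"
proof -
  have "(axis k 1 :: real^'m) $ i * M $ k $ j = M $ i $ j" for i j
    using UNIV_I[of i, unfolded k] by (simp add: axis_def)
  then show ?thesis unfolding outer_product_def vec_eq_iff vec_lambda_beta by blast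
qed

lemma convex_combination_endpoints:
  fixes x y :: "real^'n^'m"
  assumes "outer_product a b = x - y"
  shows "l *\<^sub>R x + (1 - l) *\<^sub>R y + outer_product a ((1 - l) *\<^sub>R b) = x"
    and "l *\<^sub>R x + (1 - l) *\<^sub>R y + outer_product a ((- l) *\<^sub>R b) = y"
  unfolding outer_product_scale assms by (simp_all add: algebra_simps)

text \<open>\<open>step\<close> is phrased from the intermediate point \<open>\<xi>\<close>, where
  the Morrey conditions evaluate \<open>f\<close>, with the two gradients that a laminate of weight
  \<open>l\<close> supplies.\<close>

lemma level_convex_if_rank_one_steps:
  fixes f :: "real^'n^'m \<Rightarrow> real"
  assumes dim: "CARD('n) = 1 \<or> CARD('m) = 1"
    and step: "\<And>\<xi> a b l. 0 < l \<Longrightarrow> l < 1 \<Longrightarrow>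
      f \<xi> \<le> max (f (\<xi> + outer_product a ((1 - l) *\<^sub>R b))) (f (\<xi> + outer_product a ((- l) *\<^sub>R b)))"
  shows "level_convex f"
  unfolding level_convex_on_def
proof (intro ballI allI impI)
  fix x y :: "real^'n^'m" and l :: real assume l: "0 < l \<and> l < 1"
  have "\<exists>a b. outer_product a b = x - y"
    using dim
  proof
    assume "CARD('n) = 1"
    then obtain k where "(UNIV :: 'n set) = {k}" by (auto simp: card_1_singleton_iff)
    then show ?thesis using outer_product_column by blast
  next
    assume "CARD('m) = 1"
    then obtain k where "(UNIV :: 'm set) = {k}" by (auto simp: card_1_singleton_iff)
    then show ?thesis using outer_product_row by blast
  qed
  then obtain a b where "outer_product a b = x - y" by blast
  note e = convex_combination_endpoints[OF this]
  show "f (l *\<^sub>R x + (1 - l) *\<^sub>R y) \<le> max (f x) (f y)"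
    using step[of l "l *\<^sub>R x + (1 - l) *\<^sub>R y" a b] l unfolding e by blast
qed

text \<open>The order of choices is decisive: \<open>K\<close> is fixed before
  \<open>\<delta>\<close>, the period \<open>s\<close> after it. This works because the gradients of
  a laminate do not depend on its period.\<close>

lemma strong_morrey_rank_one_step:
  fixes f :: "real^'n^'m \<Rightarrow> real"
  assumes strong: "strong_morrey_qc f" and l: "0 < l" "l < 1"
  shows "f \<xi> \<le> max (f (\<xi> + outer_product a ((1 - l) *\<^sub>R b))) (f (\<xi> + outer_product a ((- l) *\<^sub>R b)))"
    (is "_ \<le> ?m")
proof (rule field_le_epsilon)
  fix \<epsilon> :: real assume e: "0 < \<epsilon>"
  define K where "K = max (norm (outer_product a ((1 - l) *\<^sub>R b))) (norm (outer_product a ((- l) *\<^sub>R b))) + 1"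
  have K: "0 < K" unfolding K_def using norm_ge_zero[of "outer_product a ((1 - l) *\<^sub>R b)"] by linarith
  obtain \<delta> where \<delta>: "0 < \<delta>" "\<forall>\<phi>. \<phi> \<in> W1inf_Q \<and> ess_sup_Q (\<lambda>x. norm (grad \<phi> x)) \<le> ereal K \<and>
      (\<forall>x\<in>frontier unit_cube. norm (\<phi> x) \<le> \<delta>) \<longrightarrow> ereal (f \<xi>) \<le> ess_sup_Q (\<lambda>x. f (\<xi> + grad \<phi> x)) + ereal \<epsilon>"
    using strong[unfolded strong_morrey_qc_def, rule_format, OF e K, of \<xi>] by (elim exE conjE)
  \<comment> \<open>The laminate is at most \<open>s\<close> high, so the test map stays below
    \<open>s * norm a \<le> \<delta>\<close>; the \<open>+ 1\<close> covers
    \<open>a = 0\<close>.\<close>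
  define s where "s = \<delta> / (norm a + 1)"
  have s: "0 < s" using \<delta>(1) by (simp add: s_def add_nonneg_pos)
  have "norm a + 1 \<noteq> 0" using norm_ge_zero[of a] by linarith
  then have "s * (norm a + 1) = \<delta>" unfolding s_def times_divide_eq_left by (rule nonzero_mult_div_cancel_right)
  then have "s * norm a \<le> \<delta>" using s by (simp add: distrib_left)
  let ?\<phi> = "\<lambda>x. laminate l b s x *\<^sub>R a"
  have "?\<phi> \<in> W1inf_Q" unfolding W1inf_Q_def
    using lipschitz_on_subset[OF lipschitz_on_scaleR_const[OF lipschitz_on_laminate[OF l]] subset_UNIV] by blast
  moreover have "ess_sup_Q (\<lambda>x. norm (grad ?\<phi> x)) \<le> ereal K"
    by (rule ess_sup_Q_laminate[OF l s]) (auto simp: K_def)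
  moreover have "norm (?\<phi> x) \<le> \<delta>" for x
  proof -
    have "norm (?\<phi> x) \<le> s * norm a"
      using laminate_bounds[OF l s, of b x] by (simp add: mult_right_mono)
    with \<open>s * norm a \<le> \<delta>\<close> show ?thesis by linarith
  qed
  ultimately have "ereal (f \<xi>) \<le> ess_sup_Q (\<lambda>x. f (\<xi> + grad ?\<phi> x)) + ereal \<epsilon>"
    using \<delta>(2) by blast
  also have "\<dots> \<le> ereal ?m + ereal \<epsilon>"
    by (rule add_right_mono) (rule ess_sup_Q_laminate[OF l s, where h = "\<lambda>M. f (\<xi> + M)"], auto)
  finally show "f \<xi> \<le> ?m + \<epsilon>" by (simp only: plus_ereal.simps ereal_less_eq)
qed

lemma usc_nearby:
  fixes f :: "'a::real_normed_vector \<Rightarrow> real"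
  assumes "usc f" "0 < e"
  obtains d where "0 < d" "\<And>y. norm y < d \<Longrightarrow> f (x + y) \<le> f x + e"
proof -
  have "\<forall>\<^sub>F y in at x. f y < f x + e" using assms by (auto simp: usc_def)
  then obtain d where d: "d > 0" "\<And>y. y \<noteq> x \<Longrightarrow> dist y x < d \<Longrightarrow> f y < f x + e"
    unfolding eventually_at by auto
  have "f (x + y) \<le> f x + e" if "norm y < d" for y
    using d(2)[of "x + y"] that assms(2) by (cases "y = 0") (auto simp: dist_norm)
  with d(1) show thesis using that by blast
qed

text \<open>The penalty slope \<open>r\<close> is the price for vanishing on the boundary. Any
  positive \<open>r\<close> gives an admissible test function, so it can be chosen after the radii
  on which upper semicontinuity holds at the two end points.\<close>

lemma weak_morrey_usc_rank_one_step:
  fixes f :: "real^'n^'m \<Rightarrow> real"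
  assumes weak: "weak_morrey_qc f \<or> periodic_weak_morrey_qc f" and "usc f" and l: "0 < l" "l < 1"
  shows "f \<xi> \<le> max (f (\<xi> + outer_product a ((1 - l) *\<^sub>R b))) (f (\<xi> + outer_product a ((- l) *\<^sub>R b)))"
    (is "_ \<le> max (f ?x) (f ?y)")
proof (rule field_le_epsilon)
  fix \<epsilon> :: real assume e: "0 < \<epsilon>"
  obtain d1 where d1: "0 < d1" "\<And>M. norm M < d1 \<Longrightarrow> f (?x + M) \<le> f ?x + \<epsilon>"
    by (rule usc_nearby[OF \<open>usc f\<close> e, of ?x]) (rule that)
  obtain d2 where d2: "0 < d2" "\<And>M. norm M < d2 \<Longrightarrow> f (?y + M) \<le> f ?y + \<epsilon>"
    by (rule usc_nearby[OF \<open>usc f\<close> e, of ?y]) (rule that)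
  \<comment> \<open>\<open>c\<close> bounds the norm of the perturbation per unit of
    \<open>r\<close>; the \<open>+ 1\<close> in \<open>r\<close> makes the bound strict and covers
    \<open>c = 0\<close>.\<close>
  define c where "c = real CARD('m) * (real CARD('n) * norm a)"
  define r where "r = min d1 d2 / (c + 1)"
  have c: "0 \<le> c" by (simp add: c_def)
  then have r: "0 < r" using d1 d2 by (simp add: r_def)
  have small: "norm (outer_product a (axis i t :: real^'n)) < min d1 d2" if "\<bar>t\<bar> = r" for i t
  proof -
    have "norm (outer_product a (axis i t :: real^'n)) \<le> real CARD('m) * (real CARD('n) * (r * norm a))"
    proof (rule norm_matrix_le)
      fix k j show "\<bar>outer_product a (axis i t :: real^'n) $ k $ j\<bar> \<le> r * norm a"
        using component_le_norm_cart[of a k] that r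
        by (auto simp: outer_product_def axis_def abs_mult mult.commute intro: mult_right_mono)
    qed
    also have "\<dots> = r * c" by (simp add: c_def)
    also have "\<dots> < r * (c + 1)" using r by simp
    also have "\<dots> = min d1 d2" using c by (simp add: r_def)
    finally show ?thesis .
  qed
  have "ereal (f \<xi>) \<le> ess_sup_Q (\<lambda>x. f (\<xi> + grad (\<lambda>x. branching l b r x *\<^sub>R a) x))"
    using weak
  proof (rule weak_morrey_test)
    show "(norm b + r)-lipschitz_on UNIV (branching l b r)" by (rule lipschitz_on_branching[OF l]) (use r in simp)
    show "0 \<le> branching l b r x" for x by (rule branching_nonneg[OF l])
    show "branching l b r x = 0" if "x \<notin> unit_cube" for x
      by (rule branching_outside[OF l _ that]) (use r in simp)
  qed
  also have "\<dots> \<le> ereal (max (f ?x) (f ?y) + \<epsilon>)"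
  proof (rule ess_sup_Q_branching[OF l r, where h = "\<lambda>M. f (\<xi> + M)"])
    fix p q :: "real^'n" assume p: "p \<in> {(1 - l) *\<^sub>R b, (- l) *\<^sub>R b}" and "q = 0 \<or> (\<exists>i. q = axis i r \<or> q = axis i (- r))"
    then consider "q = 0" | i where "q = axis i r" | i where "q = axis i (- r)" by blast
    then have q: "norm (outer_product a q) < min d1 d2"
    proof cases
      case 1 then show ?thesis using d1(1) d2(1) by simp
    next
      case (2 i) then show ?thesis using small[of r i] r by simp
    next
      case (3 i) then show ?thesis using small[of "- r" i] r by simp
    qed
    have "f (\<xi> + outer_product a p + outer_product a q) \<le> max (f ?x) (f ?y) + \<epsilon>"
      using p
    proof (elim insertE emptyE)
      assume p: "p = (1 - l) *\<^sub>R b"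
      have "f (?x + outer_product a q) \<le> f ?x + \<epsilon>" by (rule d1(2)) (use q in simp)
      then show ?thesis unfolding p by linarith
    next
      assume p: "p = (- l) *\<^sub>R b"
      have "f (?y + outer_product a q) \<le> f ?y + \<epsilon>" by (rule d2(2)) (use q in simp)
      then show ?thesis unfolding p by linarith
    qed
    then show "f (\<xi> + outer_product a (p + q)) \<le> max (f ?x) (f ?y) + \<epsilon>"
      by (simp add: outer_product_add add.assoc)
  qed
  finally show "f \<xi> \<le> max (f ?x) (f ?y) + \<epsilon>" by (simp only: ereal_less_eq)
qed

text \<open>The tent peaks at \<open>l - 1/2\<close>: it rises with slope \<open>1 - l\<close> on
  the fraction \<open>l\<close> of the interval and falls with slope \<open>- l\<close> on the rest,
  so it returns to 0 by itself. Its gradients are exact, and the essential supremum sees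
  \<open>f\<close> only at \<open>x\<close> and \<open>y\<close>.\<close>

lemma weak_morrey_imp_level_convex_one_dim:
  fixes f :: "real^'n^'m \<Rightarrow> real"
  assumes weak: "weak_morrey_qc f \<or> periodic_weak_morrey_qc f" and n: "CARD('n) = 1"
  shows "level_convex f"
  unfolding level_convex_on_def
proof (intro ballI allI impI)
  fix x y :: "real^'n^'m" and l :: real assume "0 < l \<and> l < 1"
  then have l: "0 < l" "l < 1" by auto
  obtain k where k: "(UNIV :: 'n set) = {k}" using n by (auto simp: card_1_singleton_iff)
  define e :: "real^'n" where "e = axis k 1"
  define a where "a = column k (x - y)"
  let ?\<xi> = "l *\<^sub>R x + (1 - l) *\<^sub>R y"
  have "outer_product a e = x - y" unfolding a_def e_def by (rule outer_product_column[OF k])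
  note xy = convex_combination_endpoints[OF this, of l]
  \<comment> \<open>The tent is written with maxima and a negation of affine functions, under which
    the Lipschitz bound 1 is preserved; \<open>uz\<close> gives the readable form.\<close>
  define u where "u z = max 0 (- max ((- (1 - l) *\<^sub>R e) \<bullet> z + (- (1 - l) / 2)) ((l *\<^sub>R e) \<bullet> z + (- l / 2)))" for z
  have uz: "u z = max 0 (min ((1 - l) * (z $ k + 1/2)) (l * (1/2 - z $ k)))" for z
  proof -
    have "(- (1 - l) *\<^sub>R e) \<bullet> z + (- (1 - l) / 2) = - ((1 - l) * (z $ k + 1/2))"
      "(l *\<^sub>R e) \<bullet> z + (- l / 2) = - (l * (1/2 - z $ k))"
      by (simp_all add: e_def inner_axis' inner_diff_left field_simps)
    then show ?thesis unfolding u_def by (simp only: minus_max_eq_min minus_minus)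
  qed
  have lip: "1-lipschitz_on UNIV u" unfolding u_def
    by (intro lipschitz_on_max lipschitz_on_minus lipschitz_on_affine)
      (use l in \<open>auto simp: e_def intro: lipschitz_onI\<close>)
  have zero: "u z = 0" if z: "z \<notin> unit_cube" for z
  proof -
    obtain i where "1/2 \<le> \<bar>z $ i\<bar>" using z by (auto simp: mem_unit_cube not_less)
    moreover have "i = k" using UNIV_I[of i, unfolded k] by simp
    ultimately have "1/2 \<le> \<bar>z $ k\<bar>" by simp
    then have "z $ k + 1/2 \<le> 0 \<or> 1/2 - z $ k \<le> 0" by arith
    then have "(1 - l) * (z $ k + 1/2) \<le> 0 \<or> l * (1/2 - z $ k) \<le> 0"
      using l by (auto intro: mult_nonneg_nonpos)
    then show ?thesis unfolding uz by (simp add: min_le_iff_disj max_absorb1)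
  qed
  have "ereal (f ?\<xi>) \<le> ess_sup_Q (\<lambda>z. f (?\<xi> + grad (\<lambda>z. u z *\<^sub>R a) z))"
    using weak lip by (rule weak_morrey_test) (simp add: uz, rule zero)
  also have "\<dots> \<le> ereal (max (f x) (f y))"
  proof (rule ess_sup_Q_piecewise_affine[where h = "\<lambda>M. f (?\<xi> + M)" and
        A = "{((1 - l) *\<^sub>R e, (1 - l) / 2), ((- l) *\<^sub>R e, l / 2)}"])
    show "continuous_on unit_cube u" using lipschitz_on_continuous_on[OF lip] continuous_on_subset by blast
    show "f (?\<xi> + outer_product a p) \<le> max (f x) (f y)"
      if "(p, c) \<in> {((1 - l) *\<^sub>R e, (1 - l) / 2), ((- l) *\<^sub>R e, l / 2)}" for p c
      using that xy by auto
    fix z :: "real^'n" assume "z \<in> unit_cube"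
    then obtain d where d: "d > 0" "ball z d \<subseteq> unit_cube" using open_unit_cube open_contains_ball by blast
    have "\<exists>(p, c)\<in>{((1 - l) *\<^sub>R e, (1 - l) / 2), ((- l) *\<^sub>R e, l / 2)}. u w = p \<bullet> w + c" if "w \<in> ball z d" for w
    proof -
      have "\<bar>w $ k\<bar> < 1/2" using that d(2) by (auto simp: mem_unit_cube)
      then have "0 \<le> w $ k + 1/2" "0 \<le> 1/2 - w $ k" by linarith+
      then have "0 \<le> (1 - l) * (w $ k + 1/2)" "0 \<le> l * (1/2 - w $ k)" using l by auto
      then have "u w = min ((1 - l) * (w $ k + 1/2)) (l * (1/2 - w $ k))" unfolding uz by simp
      then have "u w = (1 - l) * (w $ k + 1/2) \<or> u w = l * (1/2 - w $ k)" by (simp add: min_def)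
      then show ?thesis by (auto simp: e_def inner_axis' algebra_simps)
    qed
    then show "\<exists>e'>0. \<exists>F\<subseteq>{((1 - l) *\<^sub>R e, (1 - l) / 2), ((- l) *\<^sub>R e, l / 2)}. finite F \<and> (\<forall>w\<in>ball z e'. \<exists>(p, c)\<in>F. u w = p \<bullet> w + c)"
      using d(1) by (intro exI[of _ d] conjI exI[of _ "{((1 - l) *\<^sub>R e, (1 - l) / 2), ((- l) *\<^sub>R e, l / 2)}"]) auto
  qed simp
  finally show "f ?\<xi> \<le> max (f x) (f y)" by (simp only: ereal_less_eq)
qed

lemma continuous_imp_lsc: "continuous_on UNIV f \<Longrightarrow> lsc f"
  and continuous_imp_usc: "continuous_on UNIV f \<Longrightarrow> usc f"
  for f :: "'a::topological_space \<Rightarrow> real"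
  unfolding lsc_def usc_def continuous_on_def order_tendsto_iff by (force, force)

theorem mainTheorem8:
  fixes f :: "real^'n^'m \<Rightarrow> real"
  assumes dim: "CARD('n) = 1 \<or> CARD('m) = 1"
  shows "(level_convex f \<longleftrightarrow> polyquasiconvex f) \<and>
         (level_convex f \<longleftrightarrow> rank_one_quasiconvex f) \<and>
         (lsc f \<longrightarrow> (level_convex f \<longleftrightarrow> strong_morrey_qc f)) \<and>
         (usc f \<longrightarrow> (level_convex f \<longleftrightarrow> weak_morrey_qc f) \<and>
                    (level_convex f \<longleftrightarrow> periodic_weak_morrey_qc f)) \<and>
         (continuous_on UNIV f \<longrightarrow>
            (level_convex f \<longleftrightarrow> polyquasiconvex f) \<and>
            (level_convex f \<longleftrightarrow> rank_one_quasiconvex f) \<and>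
            (level_convex f \<longleftrightarrow> strong_morrey_qc f) \<and>
            (level_convex f \<longleftrightarrow> weak_morrey_qc f) \<and>
            (level_convex f \<longleftrightarrow> periodic_weak_morrey_qc f)) \<and>
         (CARD('n) = 1 \<and> f \<in> borel_measurable borel \<longrightarrow>
            (level_convex f \<longleftrightarrow> weak_morrey_qc f) \<and>
            (level_convex f \<longleftrightarrow> periodic_weak_morrey_qc f))"
proof -
  have poly: "level_convex f \<longleftrightarrow> polyquasiconvex f"
    using level_convex_imp_polyquasiconvex polyquasiconvex_imp_level_convex[OF dim] by blast
  have rank: "level_convex f \<longleftrightarrow> rank_one_quasiconvex f"
    by (rule level_convex_iff_rank_one[OF dim])
  have strong: "level_convex f \<longleftrightarrow> strong_morrey_qc f" if "lsc f"
  proof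
    show "level_convex f \<Longrightarrow> strong_morrey_qc f" using that by (rule level_convex_imp_strong_morrey[rotated])
    show "level_convex f" if "strong_morrey_qc f"
      by (rule level_convex_if_rank_one_steps[OF dim], rule strong_morrey_rank_one_step[OF that])
  qed
  have weak: "level_convex f" if "usc f" "weak_morrey_qc f \<or> periodic_weak_morrey_qc f"
    by (rule level_convex_if_rank_one_steps[OF dim], rule weak_morrey_usc_rank_one_step[OF that(2,1)])
  have usc: "(level_convex f \<longleftrightarrow> weak_morrey_qc f) \<and> (level_convex f \<longleftrightarrow> periodic_weak_morrey_qc f)" if "usc f"
    using weak[OF that] level_convex_imp_weak_morrey level_convex_imp_periodic_weak_morrey by blast
  have borel: "(level_convex f \<longleftrightarrow> weak_morrey_qc f) \<and> (level_convex f \<longleftrightarrow> periodic_weak_morrey_qc f)" if "CARD('n) = 1"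
    using weak_morrey_imp_level_convex_one_dim[OF _ that] level_convex_imp_weak_morrey
      level_convex_imp_periodic_weak_morrey by blast
  show ?thesis
    using poly rank strong usc borel continuous_imp_lsc continuous_imp_usc by blast
qed

end
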